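(* Let $m>2$. There exist full harmonic morphisms $\phi:U\to\mathbb{C}$ defined on (non-empty) open subsets $U$ of $\mathbb{R}^{2m}$ which are holomorphic with respect to some Hermitian structure $J$ on $U$ but are not holomorphic with respect to any Kähler structure on $U$. Moreover, there are such examples $(\phi,J)$ of each of the following kinds: (a) $\phi$ is submersive and its fibres are superminimal with respect to $J$; (b) $\phi$ is submersive and its fibres are not superminimal with respect to any Hermitian structure on $U$; (c) $J$ is cosymplectic; (d) $J$ is not cosymplectic; (e) $\phi$ is holomorphic with respect to a family of Hermitian structures on $U$, and its fibres are superminimal with respect to some members of the family but not with respect to all of them.
   Context: $\mathbb{R}^{2m}$ carries its Euclidean metric. A harmonic morphism $\phi:U\to\mathbb{C}$ on an open set $U\subset\mathbb{R}^n$ is a smooth map with $\sum_{i=1}^n \partial^2\phi/(\partial x^i)^2=0$ and $\sum_{i=1}^n(\partial\phi/\partial x^i)^2=0$ on $U$. An almost Hermitian structure $J$ on $U$ is a smooth choice, for $x\in U$, of an orthogonal linear map $J_x:T_x\mathbb{R}^{2m}\to T_x\mathbb{R}^{2m}$ with $J_x^2=-I$. It is called a Hermitian structure if it is integrable (every point has a neighbourhood with a chart $\psi$ into $\mathbb{C}^m$ satisfying $d\psi\circ J=\mathrm{i}\,d\psi$), and a Kähler structure if it is parallel, i.e. constant in $x$. A map $\phi:U\to\mathbb{C}$ is holomorphic with respect to $J$ if $d\phi(JX)=\mathrm{i}\,d\phi(X)$ for all tangent vectors $X$. $J$ is cosymplectic if its divergence $\delta J=\sum_i(\partial_{e_i}J)(e_i)$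 vanishes, where $\{e_i\}$ is any orthonormal basis of the tangent space. An almost complex structure $J$ on $U$ is adapted to an even-dimensional submanifold $S\subset U$ if $TS$ is closed under $J$; then $S$ is superminimal with respect to $J$ if $J$ is parallel (constant) along $S$. A map $\phi:U\to\mathbb{C}$ on an open set $U\subset\mathbb{R}^n$ is full if it cannot be written as $\phi=\psi\circ\pi_A$ for some orthogonal projection $\pi_A$ of $\mathbb{R}^n$ onto a proper linear subspace $A$ and some map $\psi:\pi_A(U)\to\mathbb{C}$. *)

theory Defs
  imports "HOL-Analysis.Analysis"
begin

text \<open>\<open>C_k_on k f S\<close> and \<open>smooth_on S f\<close> are meant for open \<open>S\<close>: all iterated directional
  derivatives (in constant directions) up to order \<open>k\<close> exist as Frechet differentiable functions
  and are continuous on \<open>S\<close>.\<close>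

fun C_k_on :: "nat \<Rightarrow> ('a::real_normed_vector \<Rightarrow> 'b::real_normed_vector) \<Rightarrow> 'a set \<Rightarrow> bool" where
  "C_k_on 0 f S \<longleftrightarrow> continuous_on S f"
| "C_k_on (Suc k) f S \<longleftrightarrow>
     (\<forall>x\<in>S. f differentiable (at x)) \<and> (\<forall>v. C_k_on k (\<lambda>x. frechet_derivative f (at x) v) S)"

definition smooth_on :: "'a::real_normed_vector set \<Rightarrow> ('a \<Rightarrow> 'b::real_normed_vector) \<Rightarrow> bool" where
  "smooth_on S f \<longleftrightarrow> (\<forall>k. C_k_on k f S)"

definition partial :: "(real^'n::finite \<Rightarrow> 'b::real_normed_vector) \<Rightarrow> 'n \<Rightarrow> real^'n \<Rightarrow> 'b" where
  "partial f i x = frechet_derivative f (at x) (axis i 1)"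

definition harmonic_morphism :: "(real^'n::finite) set \<Rightarrow> (real^'n \<Rightarrow> complex) \<Rightarrow> bool" where
  "harmonic_morphism U \<phi> \<longleftrightarrow> open U \<and> smooth_on U \<phi> \<and>
     (\<forall>x\<in>U. (\<Sum>i\<in>UNIV. partial (partial \<phi> i) i x) = 0) \<and>
     (\<forall>x\<in>U. (\<Sum>i\<in>UNIV. (partial \<phi> i x)\<^sup>2) = 0)"

definition orthogonal_projection_onto :: "'a::euclidean_space set \<Rightarrow> ('a \<Rightarrow> 'a) \<Rightarrow> bool" where
  "orthogonal_projection_onto A \<pi> \<longleftrightarrow> (\<forall>x. \<pi> x \<in> A \<and> (\<forall>a\<in>A. orthogonal (x - \<pi> x) a))"

definition full_on :: "'a::euclidean_space set \<Rightarrow> ('a \<Rightarrow> complex) \<Rightarrow> bool" where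
  "full_on U \<phi> \<longleftrightarrow> \<not> (\<exists>A \<pi> (\<psi> :: 'a \<Rightarrow> complex).
     subspace A \<and> A \<noteq> UNIV \<and> orthogonal_projection_onto A \<pi> \<and> (\<forall>x\<in>U. \<phi> x = \<psi> (\<pi> x)))"

definition submersive_on :: "'a::euclidean_space set \<Rightarrow> ('a \<Rightarrow> complex) \<Rightarrow> bool" where
  "submersive_on U \<phi> \<longleftrightarrow> (\<forall>x\<in>U. \<phi> differentiable (at x) \<and> surj (frechet_derivative \<phi> (at x)))"

text \<open>An almost complex structure is a family \<open>J x\<close> of endomorphisms, only its values at points
  \<open>x\<close> of the open set \<open>U\<close> being relevant. Smoothness of \<open>x \<mapsto> J x\<close> is smoothness of \<open>x \<mapsto> J x v\<close> for
  every constant vector \<open>v\<close>, and \<open>frechet_derivative (\<lambda>y. J y w) (at x) v\<close> is \<open>(\<partial>\<^sub>v J)(w)\<close> at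
  \<open>x\<close>, that is, the flat covariant derivative of \<open>J\<close>.\<close>

definition almost_hermitian_structure ::
    "'a::euclidean_space set \<Rightarrow> ('a \<Rightarrow> 'a \<Rightarrow> 'a) \<Rightarrow> bool" where
  "almost_hermitian_structure U J \<longleftrightarrow>
     (\<forall>x\<in>U. orthogonal_transformation (J x) \<and> (\<forall>v. J x (J x v) = - v)) \<and>
     (\<forall>v. smooth_on U (\<lambda>x. J x v))"

definition chart_on ::
    "'a::real_normed_vector set \<Rightarrow> ('a \<Rightarrow> 'b::real_normed_vector) \<Rightarrow> bool" where
  "chart_on W \<psi> \<longleftrightarrow> open W \<and> open (\<psi> ` W) \<and> inj_on \<psi> W \<and>
     smooth_on W \<psi> \<and> smooth_on (\<psi> ` W) (inv_into W \<psi>)"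

text \<open>For \<open>m = CARD('m)\<close>, the space \<open>\<real>\<^sup>2\<^sup>m\<close> is \<open>real^('m + 'm)\<close>, whose coordinates are indexed by the
  disjoint union of two copies of the index type of \<open>complex^'m\<close>.\<close>

definition integrable_structure ::
    "(real^('m::finite + 'm)) set \<Rightarrow> (real^('m + 'm) \<Rightarrow> real^('m + 'm) \<Rightarrow> real^('m + 'm)) \<Rightarrow> bool" where
  "integrable_structure U J \<longleftrightarrow>
     (\<forall>x\<in>U. \<exists>W (\<psi> :: real^('m + 'm) \<Rightarrow> complex^'m). x \<in> W \<and> W \<subseteq> U \<and> chart_on W \<psi> \<and>
        (\<forall>y\<in>W. \<forall>v. frechet_derivative \<psi> (at y) (J y v) = \<i> *s frechet_derivative \<psi> (at y) v))"

definition hermitian_structure ::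
    "(real^('m::finite + 'm)) set \<Rightarrow> (real^('m + 'm) \<Rightarrow> real^('m + 'm) \<Rightarrow> real^('m + 'm)) \<Rightarrow> bool" where
  "hermitian_structure U J \<longleftrightarrow> almost_hermitian_structure U J \<and> integrable_structure U J"

text \<open>Parallel means vanishing covariant derivative, hence constant on every connected component.\<close>

definition kaehler_structure :: "'a::euclidean_space set \<Rightarrow> ('a \<Rightarrow> 'a \<Rightarrow> 'a) \<Rightarrow> bool" where
  "kaehler_structure U J \<longleftrightarrow> almost_hermitian_structure U J \<and>
     (\<forall>x\<in>U. \<forall>v w. frechet_derivative (\<lambda>y. J y w) (at x) v = 0)"

definition holomorphic_wrt ::
    "'a::euclidean_space set \<Rightarrow> ('a \<Rightarrow> 'a \<Rightarrow> 'a) \<Rightarrow> ('a \<Rightarrow> complex) \<Rightarrow> bool" where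
  "holomorphic_wrt U J \<phi> \<longleftrightarrow> (\<forall>x\<in>U. \<phi> differentiable (at x) \<and>
     (\<forall>v. frechet_derivative \<phi> (at x) (J x v) = \<i> * frechet_derivative \<phi> (at x) v))"

text \<open>The divergence is computed in the standard basis; it does not depend on the choice of the
  orthonormal basis.\<close>

definition divergence :: "('a::euclidean_space \<Rightarrow> 'a \<Rightarrow> 'a) \<Rightarrow> 'a \<Rightarrow> 'a" where
  "divergence J x = (\<Sum>e\<in>Basis. frechet_derivative (\<lambda>y. J y e) (at x) e)"

definition cosymplectic :: "'a::euclidean_space set \<Rightarrow> ('a \<Rightarrow> 'a \<Rightarrow> 'a) \<Rightarrow> bool" where
  "cosymplectic U J \<longleftrightarrow> (\<forall>x\<in>U. divergence J x = 0)"

text \<open>A \<open>d\<close>-dimensional submanifold is locally the zero set of a smooth submersion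
  \<open>(F 0, \<dots>, F (k - 1))\<close> into \<open>\<real>\<^sup>k\<close>, where \<open>k\<close> is the codimension.\<close>

definition submanifold :: "nat \<Rightarrow> 'a::euclidean_space set \<Rightarrow> bool" where
  "submanifold d S \<longleftrightarrow> d \<le> DIM('a) \<and>
     (\<forall>x\<in>S. \<exists>W (F :: nat \<Rightarrow> 'a \<Rightarrow> real). open W \<and> x \<in> W \<and>
        (\<forall>i < DIM('a) - d. smooth_on W (F i)) \<and>
        (\<forall>y\<in>W. \<forall>c :: nat \<Rightarrow> real. \<exists>v. \<forall>i < DIM('a) - d. frechet_derivative (F i) (at y) v = c i) \<and>
        S \<inter> W = {y\<in>W. \<forall>i < DIM('a) - d. F i y = 0})"

text \<open>Velocities of curves in \<open>S\<close>. For a smooth submanifold, every curve that is merely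
  differentiable at \<open>0\<close> has the velocity of a smooth one, so nothing more is required.\<close>

definition tangent_vectors :: "'a::euclidean_space set \<Rightarrow> 'a \<Rightarrow> 'a set" where
  "tangent_vectors S x = {v. \<exists>(\<gamma> :: real \<Rightarrow> 'a) \<epsilon>. \<epsilon> > 0 \<and> \<gamma> 0 = x \<and>
     (\<forall>t. \<bar>t\<bar> < \<epsilon> \<longrightarrow> \<gamma> t \<in> S) \<and> (\<gamma> has_vector_derivative v) (at 0)}"

definition adapted_to :: "('a::euclidean_space \<Rightarrow> 'a \<Rightarrow> 'a) \<Rightarrow> 'a set \<Rightarrow> bool" where
  "adapted_to J S \<longleftrightarrow> (\<forall>x\<in>S. \<forall>v\<in>tangent_vectors S x. J x v \<in> tangent_vectors S x)"

definition superminimal ::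
    "'a::euclidean_space set \<Rightarrow> ('a \<Rightarrow> 'a \<Rightarrow> 'a) \<Rightarrow> 'a set \<Rightarrow> bool" where
  "superminimal U J S \<longleftrightarrow> S \<subseteq> U \<and> (\<exists>d. even d \<and> submanifold d S) \<and> adapted_to J S \<and>
     (\<forall>x\<in>S. \<forall>v\<in>tangent_vectors S x. \<forall>w. frechet_derivative (\<lambda>y. J y w) (at x) v = 0)"

definition superminimal_fibres ::
    "'a::euclidean_space set \<Rightarrow> ('a \<Rightarrow> 'a \<Rightarrow> 'a) \<Rightarrow> ('a \<Rightarrow> complex) \<Rightarrow> bool" where
  "superminimal_fibres U J \<phi> \<longleftrightarrow> (\<forall>c\<in>\<phi> ` U. superminimal U J {x\<in>U. \<phi> x = c})"

definition full_non_kaehler_example ::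
    "(real^('m::finite + 'm)) set \<Rightarrow> (real^('m + 'm) \<Rightarrow> complex) \<Rightarrow>
     (real^('m + 'm) \<Rightarrow> real^('m + 'm) \<Rightarrow> real^('m + 'm)) \<Rightarrow> bool" where
  "full_non_kaehler_example U \<phi> J \<longleftrightarrow>
     open U \<and> U \<noteq> {} \<and> harmonic_morphism U \<phi> \<and> full_on U \<phi> \<and>
     hermitian_structure U J \<and> holomorphic_wrt U J \<phi> \<and>
     (\<forall>K. kaehler_structure U K \<longrightarrow> \<not> holomorphic_wrt U K \<phi>)"

end

theory Submission
  imports Defs
begin

text \<open>Fix three complex coordinates \<open>z\<^sub>a, z\<^sub>b, z\<^sub>c\<close> and let \<open>g\<close> be the sum of the squares of the
  others. For \<open>J0\<close> with \<open>(1,0)\<close>-covectors \<open>dz\<^sub>a + z\<^sub>c d(cnj z\<^sub>b)\<close>, \<open>dz\<^sub>b - z\<^sub>c d(cnj z\<^sub>a)\<close>, \<open>dz\<^sub>k\<close>, the functions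
  \<open>W1 = z\<^sub>a + z\<^sub>c (cnj z\<^sub>b)\<close>, \<open>W2 = z\<^sub>b - z\<^sub>c (cnj z\<^sub>a)\<close> and \<open>z\<^sub>k\<close> are global holomorphic coordinates, and \<open>J0\<close> is
  cosymplectic, so that every holomorphic function of them is a harmonic morphism. Two such
  functions give all examples.

  The function \<open>\<phi>1 = (W1 + g) / (1 + W2)\<close> is also holomorphic for a second structure \<open>J1\<close>, of the opposite
  orientation, which depends on the value of \<open>\<phi>1\<close> only: its fibres are superminimal for \<open>J1\<close>, but
  not for \<open>J0\<close>, and \<open>J1\<close> is not cosymplectic. The fibre of \<open>\<phi>2 = W1 + z\<^sub>c\<^sup>2 W2 + g\<close> over \<open>0\<close> contains the
  \<open>z\<^sub>c\<close>-axis, along which the covectors \<open>d\<phi>2\<close> are pairwise non-orthogonal for the complex bilinear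
  pairing. A complex structure that is constant along this fibre and preserves its tangent spaces
  would make two of any three of them orthogonal. Kaehler structures are excluded by the same pairing.\<close>

section \<open>Smooth maps\<close>

text \<open>Functions that agree on an open set have the same derivatives there. The induction
  varies both functions because its step passes to their directional derivatives. This is what lets
  a derivative be replaced by a formula valid only on \<open>S\<close>.\<close>

lemma C_k_on_cong:
  assumes "open S" "C_k_on k f S" "\<And>x. x \<in> S \<Longrightarrow> f x = g x"
  shows "C_k_on k g S"
  using assms(2,3)
proof (induction k arbitrary: f g)
  case 0
  then show ?case using continuous_on_cong[of S S f g] by simp
next
  case (Suc k)
  have d: "(g has_derivative frechet_derivative f (at x)) (at x)" if "x \<in> S" for x
  proof (rule has_derivative_transform_within_open[OF _ \<open>open S\<close> that])
    show "(f has_derivative frechet_derivative f (at x)) (at x)"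
      using Suc.prems(1) that by (auto simp: frechet_derivative_works)
  qed (use Suc.prems in auto)
  have "C_k_on k (\<lambda>x. frechet_derivative g (at x) v) S" for v
    by (rule Suc.IH[of "\<lambda>x. frechet_derivative f (at x) v"])
      (use Suc.prems frechet_derivative_at[OF d] in auto)
  with d show ?case by (auto simp: differentiable_def)
qed

lemma C_k_on_Suc_imp: "C_k_on (Suc k) f S \<Longrightarrow> C_k_on k f S"
proof (induction k arbitrary: f)
  case 0
  then show ?case
    by (auto intro!: continuous_at_imp_continuous_on differentiable_imp_continuous_within)
next
  case (Suc k)
  then have d: "\<forall>x\<in>S. f differentiable (at x)"
    and c: "\<forall>v. C_k_on (Suc k) (\<lambda>x. frechet_derivative f (at x) v) S"
    using C_k_on.simps(2)[of "Suc k" f S] by blast+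
  from c Suc.IH have "\<forall>v. C_k_on k (\<lambda>x. frechet_derivative f (at x) v) S"
    by blast
  with d show ?case using C_k_on.simps(2)[of k f S] by blast
qed

lemma C_k_on_const: "C_k_on k (\<lambda>x. c) S"
proof (induction k arbitrary: c)
  case (Suc k)
  then show ?case by (simp add: frechet_derivative_const)
qed simp

lemma C_k_on_linear_compose:
  assumes "open S" "bounded_linear h" "C_k_on k f S"
  shows "C_k_on k (\<lambda>x. h (f x)) S"
  using assms(3)
proof (induction k arbitrary: f)
  case 0
  then show ?case using bounded_linear.continuous_on[OF assms(2)] by auto
next
  case (Suc k)
  have d: "((\<lambda>x. h (f x)) has_derivative (\<lambda>v. h (frechet_derivative f (at x) v))) (at x)"
    if "x \<in> S" for x
    using Suc.prems that frechet_derivative_works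
    by (intro bounded_linear.has_derivative[OF assms(2)]) (auto simp: frechet_derivative_works)
  have "C_k_on k (\<lambda>x. frechet_derivative (\<lambda>x. h (f x)) (at x) v) S" for v
    by (rule C_k_on_cong[OF assms(1) Suc.IH[of "\<lambda>x. frechet_derivative f (at x) v"]])
      (use Suc.prems frechet_derivative_at[OF d] in \<open>auto dest: fun_cong\<close>)
  with d show ?case by (auto simp: differentiable_def)
qed

lemma C_k_on_add:
  assumes "open S" "C_k_on k f S" "C_k_on k g S"
  shows "C_k_on k (\<lambda>x. f x + g x) S"
  using assms(2,3)
proof (induction k arbitrary: f g)
  case 0
  then show ?case by (auto intro: continuous_intros)
next
  case (Suc k)
  have d: "((\<lambda>x. f x + g x) has_derivative
      (\<lambda>v. frechet_derivative f (at x) v + frechet_derivative g (at x) v)) (at x)"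
    if "x \<in> S" for x
    using Suc.prems that by (intro has_derivative_add) (auto simp: frechet_derivative_works)
  have "C_k_on k (\<lambda>x. frechet_derivative (\<lambda>x. f x + g x) (at x) v) S" for v
    by (rule C_k_on_cong[OF assms(1) Suc.IH[of "\<lambda>x. frechet_derivative f (at x) v"
          "\<lambda>x. frechet_derivative g (at x) v"]])
      (use Suc.prems frechet_derivative_at[OF d] in \<open>auto dest: fun_cong\<close>)
  with d show ?case by (auto simp: differentiable_def)
qed

text \<open>By the product rule the derivative is a sum of two products, each combining a
  directional derivative with an undifferentiated factor, which \<open>C_k_on_Suc_imp\<close> lowers
  to order \<open>k\<close>. Hence the induction runs over arbitrary \<open>f\<close> and
  \<open>g\<close>.\<close>

lemma C_k_on_bilinear:
  assumes "open S" "bounded_bilinear h" "C_k_on k f S" "C_k_on k g S"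
  shows "C_k_on k (\<lambda>x. h (f x) (g x)) S"
  using assms(3,4)
proof (induction k arbitrary: f g)
  case 0
  then show ?case using bounded_bilinear.continuous_on[OF assms(2)] by auto
next
  case (Suc k)
  have d: "((\<lambda>x. h (f x) (g x)) has_derivative
      (\<lambda>v. h (f x) (frechet_derivative g (at x) v) + h (frechet_derivative f (at x) v) (g x))) (at x)"
    if "x \<in> S" for x
    using Suc.prems that
    by (intro bounded_bilinear.FDERIV[OF assms(2)]) (auto simp: frechet_derivative_works)
  have "C_k_on k (\<lambda>x. frechet_derivative (\<lambda>x. h (f x) (g x)) (at x) v) S" for v
  proof (rule C_k_on_cong[OF assms(1)])
    show "C_k_on k (\<lambda>x. h (f x) (frechet_derivative g (at x) v)
        + h (frechet_derivative f (at x) v) (g x)) S"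
      using Suc.prems by (intro C_k_on_add[OF assms(1)] Suc.IH C_k_on_Suc_imp[of k f]
          C_k_on_Suc_imp[of k g]) auto
  qed (use frechet_derivative_at[OF d] in \<open>auto dest: fun_cong\<close>)
  with d show ?case by (auto simp: differentiable_def)
qed

text \<open>The derivative of the reciprocal is a product of the derivative of \<open>f\<close> with
  the reciprocal itself, so the induction hypothesis for the same \<open>f\<close> suffices.\<close>

lemma C_k_on_inverse:
  fixes f :: "'a::real_normed_vector \<Rightarrow> 'b::real_normed_field"
  assumes "open S" "\<And>x. x \<in> S \<Longrightarrow> f x \<noteq> 0" "C_k_on k f S"
  shows "C_k_on k (\<lambda>x. inverse (f x)) S"
  using assms(3)
proof (induction k)
  case 0
  then show ?case using assms(2) by (auto intro!: continuous_intros)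
next
  case (Suc k)
  have d: "((\<lambda>x. inverse (f x)) has_derivative
      (\<lambda>v. - (inverse (f x) * frechet_derivative f (at x) v * inverse (f x)))) (at x)"
    if "x \<in> S" for x
    using Suc.prems that assms(2)
    by (intro Deriv.has_derivative_inverse) (auto simp: frechet_derivative_works)
  have "C_k_on k (\<lambda>x. frechet_derivative (\<lambda>x. inverse (f x)) (at x) v) S" for v
  proof (rule C_k_on_cong[OF assms(1)])
    have i: "C_k_on k (\<lambda>x. inverse (f x)) S"
      using Suc.IH C_k_on_Suc_imp[OF Suc.prems] .
    show "C_k_on k (\<lambda>x. - (inverse (f x) * frechet_derivative f (at x) v * inverse (f x))) S"
      using Suc.prems i
      by (intro C_k_on_linear_compose[OF assms(1) bounded_linear_minus[OF bounded_linear_ident]]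
          C_k_on_bilinear[OF assms(1) bounded_bilinear_mult]) auto
  qed (use frechet_derivative_at[OF d] in \<open>auto dest: fun_cong\<close>)
  with d show ?case by (auto simp: differentiable_def)
qed

section \<open>Closure properties of smooth maps\<close>

lemma smooth_on_cong:
  "open S \<Longrightarrow> smooth_on S f \<Longrightarrow> (\<And>x. x \<in> S \<Longrightarrow> f x = g x) \<Longrightarrow> smooth_on S g"
  unfolding smooth_on_def using C_k_on_cong by blast

lemma smooth_on_const: "smooth_on S (\<lambda>x. c)"
  by (simp add: smooth_on_def C_k_on_const)

lemma smooth_on_linear_compose:
  "open S \<Longrightarrow> bounded_linear h \<Longrightarrow> smooth_on S f \<Longrightarrow> smooth_on S (\<lambda>x. h (f x))"
  by (simp add: smooth_on_def C_k_on_linear_compose)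

lemma smooth_on_add:
  "open S \<Longrightarrow> smooth_on S f \<Longrightarrow> smooth_on S g \<Longrightarrow> smooth_on S (\<lambda>x. f x + g x)"
  by (simp add: smooth_on_def C_k_on_add)

lemma smooth_on_bilinear:
  "open S \<Longrightarrow> bounded_bilinear h \<Longrightarrow> smooth_on S f \<Longrightarrow> smooth_on S g
    \<Longrightarrow> smooth_on S (\<lambda>x. h (f x) (g x))"
  by (simp add: smooth_on_def C_k_on_bilinear)

lemmas smooth_on_mult = smooth_on_bilinear[OF _ bounded_bilinear_mult]

lemma smooth_on_inverse:
  fixes f :: "'a::real_normed_vector \<Rightarrow> 'b::real_normed_field"
  shows "open S \<Longrightarrow> (\<And>x. x \<in> S \<Longrightarrow> f x \<noteq> 0) \<Longrightarrow> smooth_on S f \<Longrightarrow> smooth_on S (\<lambda>x. inverse (f x))"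
  by (simp add: smooth_on_def C_k_on_inverse)

lemma smooth_on_minus: "open S \<Longrightarrow> smooth_on S f \<Longrightarrow> smooth_on S (\<lambda>x. - f x)"
  using smooth_on_linear_compose[OF _ bounded_linear_minus[OF bounded_linear_ident]] .

lemma smooth_on_diff:
  "open S \<Longrightarrow> smooth_on S f \<Longrightarrow> smooth_on S g \<Longrightarrow> smooth_on S (\<lambda>x. f x - g x)"
  using smooth_on_add[OF _ _ smooth_on_minus] by fastforce

lemma smooth_on_divide:
  fixes f :: "'a::real_normed_vector \<Rightarrow> 'b::real_normed_field"
  shows "open S \<Longrightarrow> (\<And>x. x \<in> S \<Longrightarrow> g x \<noteq> 0) \<Longrightarrow> smooth_on S f \<Longrightarrow> smooth_on S g
    \<Longrightarrow> smooth_on S (\<lambda>x. f x / g x)"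
  unfolding divide_inverse by (intro smooth_on_mult smooth_on_inverse)

lemma smooth_on_cnj: "open S \<Longrightarrow> smooth_on S f \<Longrightarrow> smooth_on S (\<lambda>x. cnj (f x))"
  by (rule smooth_on_linear_compose[OF _ bounded_linear_cnj])

lemma smooth_on_sum:
  "open S \<Longrightarrow> (\<And>i. i \<in> I \<Longrightarrow> smooth_on S (f i)) \<Longrightarrow> smooth_on S (\<lambda>x. \<Sum>i\<in>I. f i x)"
  by (induction I rule: infinite_finite_induct) (simp_all add: smooth_on_const smooth_on_add)

lemma smooth_on_D:
  assumes "smooth_on S f" "x \<in> S"
  shows "f differentiable at x" "(f has_derivative frechet_derivative f (at x)) (at x)"
proof -
  have "C_k_on (Suc 0) f S"
    using assms(1) unfolding smooth_on_def by blast
  then show "f differentiable at x" "(f has_derivative frechet_derivative f (at x)) (at x)"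
    using assms(2) by (auto simp: frechet_derivative_works)
qed

lemma smooth_on_frechet_derivative:
  "smooth_on S f \<Longrightarrow> smooth_on S (\<lambda>x. frechet_derivative f (at x) v)"
  unfolding smooth_on_def using C_k_on.simps(2)[of _ f S] by blast

lemma smooth_on_bounded_linear:
  assumes "open S" "bounded_linear h"
  shows "smooth_on S h"
proof -
  have "C_k_on k h S" for k
  proof (cases k)
    case 0
    then show ?thesis using linear_continuous_on[OF assms(2)] by simp
  next
    case (Suc j)
    have "frechet_derivative h (at x) = h" for x
      using frechet_derivative_at[OF bounded_linear_imp_has_derivative[OF assms(2)]] by simp
    then show ?thesis
      using Suc bounded_linear_imp_differentiable[OF assms(2)] by (simp add: C_k_on_const)
  qed
  then show ?thesis by (simp add: smooth_on_def)
qed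

section \<open>Vector-valued maps and explicit charts\<close>

lemma bounded_linear_axis:
  "bounded_linear (axis i :: 'b::euclidean_space \<Rightarrow> 'b^'n)"
  by (auto intro!: linear_conv_bounded_linear[THEN iffD1] linearI simp: vec_eq_iff axis_def)

lemma vec_lambda_eq_sum_axis:
  "(\<chi> i. f i) = (\<Sum>i\<in>UNIV. axis i (f i :: 'b::euclidean_space) :: 'b^'n)"
  by (simp add: vec_eq_iff axis_def if_distrib cong: if_cong)

lemma smooth_on_vec:
  fixes f :: "'n::finite \<Rightarrow> 'a::real_normed_vector \<Rightarrow> 'b::euclidean_space"
  assumes "open S" "\<And>i. smooth_on S (f i)"
  shows "smooth_on S (\<lambda>x. \<chi> i. f i x)"
  unfolding vec_lambda_eq_sum_axis
  by (intro smooth_on_sum smooth_on_linear_compose[OF _ bounded_linear_axis] assms)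

lemma has_derivative_vec:
  fixes f :: "'n::finite \<Rightarrow> 'a::real_normed_vector \<Rightarrow> 'b::euclidean_space"
  assumes "\<And>i. (f i has_derivative f' i) F"
  shows "((\<lambda>x. \<chi> i. f i x) has_derivative (\<lambda>v. \<chi> i. f' i v)) F"
  unfolding vec_lambda_eq_sum_axis
  by (intro has_derivative_sum bounded_linear.has_derivative[OF bounded_linear_axis] assms)

text \<open>Since \<open>\<eta>\<close> is defined on the whole space, \<open>l\<close> and
  \<open>r\<close> identify the image of \<open>W\<close> with the preimage of \<open>W\<close>
  under \<open>\<eta>\<close>. The image is therefore open, and the inverse chart agrees on it with
  \<open>\<eta>\<close> and inherits its smoothness.\<close>

lemma chart_on_explicit:
  assumes "open W" "smooth_on W \<psi>" "smooth_on UNIV \<eta>"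
    and l: "\<And>x. x \<in> W \<Longrightarrow> \<eta> (\<psi> x) = x" and r: "\<And>w. \<eta> w \<in> W \<Longrightarrow> \<psi> (\<eta> w) = w"
  shows "chart_on W \<psi>"
proof -
  have im: "\<psi> ` W = \<eta> -` W"
    using l r by (force simp: image_iff)
  have "continuous_on UNIV \<eta>"
    using assms(3)[unfolded smooth_on_def, rule_format, of 0] by simp
  then have o: "open (\<psi> ` W)"
    unfolding im using \<open>open W\<close> by (simp add: open_vimage)
  have inj: "inj_on \<psi> W"
    using l by (rule inj_on_inverseI)
  \<comment> \<open>Differentiability in \<open>C_k_on\<close> refers to full neighbourhoods, so it
    passes to arbitrary subsets.\<close>
  have "C_k_on k \<eta> UNIV \<Longrightarrow> C_k_on k \<eta> T" for k T and \<eta> :: "'b \<Rightarrow> 'a"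
    by (induction k arbitrary: \<eta>) (auto intro: continuous_on_subset)
  then have "smooth_on (\<psi> ` W) \<eta>"
    using assms(3) by (simp add: smooth_on_def)
  then have "smooth_on (\<psi> ` W) (inv_into W \<psi>)"
    by (rule smooth_on_cong[OF o]) (use l inj in auto)
  then show ?thesis
    using assms o inj by (simp add: chart_on_def)
qed

abbreviation FD :: "('a::real_normed_vector \<Rightarrow> 'b::real_normed_vector) \<Rightarrow> 'a \<Rightarrow> 'a \<Rightarrow> 'b" where
  "FD f x \<equiv> frechet_derivative f (at x)"

section \<open>The bilinear pairing of complex covectors\<close>

text \<open>Complex bilinear rather than Hermitian, so that the vanishing of
  \<open>pairing (FD f x) (FD f x)\<close> is the second equation of a harmonic morphism.\<close>

definition pairing :: "(real^'n::finite \<Rightarrow> complex) \<Rightarrow> (real^'n \<Rightarrow> complex) \<Rightarrow> complex" where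
  "pairing A B = (\<Sum>i\<in>UNIV. A (axis i 1) * B (axis i 1))"

lemma linear_axis_expansion:
  fixes B :: "real^'n::finite \<Rightarrow> complex"
  assumes "linear B"
  shows "B w = (\<Sum>j\<in>UNIV. of_real (w $ j) * B (axis j 1))"
proof -
  have "B w = B (\<Sum>j\<in>UNIV. (w $ j) *\<^sub>R axis j 1)"
    using basis_expansion[of w] by (simp add: scalar_mult_eq_scaleR)
  also have "\<dots> = (\<Sum>j\<in>UNIV. (w $ j) *\<^sub>R B (axis j 1))"
    by (simp add: linear_sum[OF assms] linear_cmul[OF assms])
  finally show ?thesis by (simp add: scaleR_conv_of_real)
qed

section \<open>Orthogonal complex structures acting on covectors\<close>

locale orthogonal_complex =
  fixes J :: "'a::euclidean_space \<Rightarrow> 'a"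
  assumes orth: "orthogonal_transformation J" and square: "\<And>v. J (J v) = - v"
begin

lemma linear_J: "linear J"
  using orth by (rule orthogonal_transformation_linear)

lemma skew: "J u \<bullet> v = - (u \<bullet> J v)"
  using orth square unfolding orthogonal_transformation_def by (metis inner_minus_left)

end

lemma almost_hermitian_orthogonal_complex:
  "almost_hermitian_structure U J \<Longrightarrow> x \<in> U \<Longrightarrow> orthogonal_complex (J x)"
  by (simp add: almost_hermitian_structure_def orthogonal_complex_def)

text \<open>An orthogonal \<open>J\<close> with square \<open>-1\<close> has a skew matrix in the
  standard basis, and the pairing is the bilinear extension of the Euclidean inner product.\<close>

lemma pairing_skew:
  fixes J :: "real^'n::finite \<Rightarrow> real^'n"
  assumes "orthogonal_complex J" and A: "linear A" and B: "linear B"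
  shows "pairing A (\<lambda>v. B (J v)) = - pairing (\<lambda>v. A (J v)) B"
proof -
  interpret orthogonal_complex J by fact
  have sk: "J (axis i 1) $ j = - (J (axis j 1) $ i)" for i j
    using skew[of "axis i 1" "axis j 1"] by (simp add: inner_axis inner_axis')
  have "pairing A (\<lambda>v. B (J v)) =
      (\<Sum>i\<in>UNIV. \<Sum>j\<in>UNIV. A (axis i 1) * (of_real (J (axis i 1) $ j) * B (axis j 1)))"
    unfolding pairing_def by (subst linear_axis_expansion[OF B]) (simp add: sum_distrib_left)
  also have "\<dots> = (\<Sum>i\<in>UNIV. \<Sum>j\<in>UNIV. - (of_real (J (axis j 1) $ i) * A (axis i 1) * B (axis j 1)))"
    by (subst sk) (simp add: mult_ac)
  also have "\<dots> = (\<Sum>j\<in>UNIV. \<Sum>i\<in>UNIV. - (of_real (J (axis j 1) $ i) * A (axis i 1) * B (axis j 1)))"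
    by (rule sum.swap)
  also have "\<dots> = - (\<Sum>j\<in>UNIV. (\<Sum>i\<in>UNIV. of_real (J (axis j 1) $ i) * A (axis i 1)) * B (axis j 1))"
    by (simp add: sum_negf sum_distrib_right)
  also have "\<dots> = - pairing (\<lambda>v. A (J v)) B"
    unfolding pairing_def by (simp add: linear_axis_expansion[OF A, of "J _"])
  finally show ?thesis .
qed

text \<open>Skewness turns \<open>\<kappa>\<close> times the pairing into its own negative. Thus the
  eigenspaces of \<open>J\<close> on complex covectors are isotropic; \<open>\<kappa>\<close> stays
  free to cover both \<open>\<i>\<close> and \<open>-\<i>\<close>.\<close>

lemma pairing_zero:
  fixes J :: "real^'n::finite \<Rightarrow> real^'n"
  assumes "orthogonal_complex J" "linear A" "linear B" "\<kappa> \<noteq> 0"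
    and "\<And>v. A (J v) = \<kappa> * A v" "\<And>v. B (J v) = \<kappa> * B v"
  shows "pairing A B = 0"
proof -
  have "\<kappa> * pairing A B = pairing A (\<lambda>v. B (J v))"
    using assms(6) by (simp add: pairing_def sum_distrib_left mult_ac)
  also have "\<dots> = - (\<kappa> * pairing A B)"
    using pairing_skew[OF assms(1-3)] assms(5) by (simp add: pairing_def sum_distrib_left mult_ac)
  finally show ?thesis using \<open>\<kappa> \<noteq> 0\<close> by simp
qed

text \<open>Invariance of the kernel makes \<open>A (J v)\<close> a real linear function of
  \<open>A v\<close>, of the form \<open>p * A v + r * cnj (A v)\<close>. Isotropy forces
  \<open>p * r = 0\<close>, and \<open>J\<close> having square \<open>-1\<close> gives
  \<open>p\<^sup>2 + r * cnj r = -1\<close>, which leaves \<open>r = 0\<close> and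
  \<open>p = \<i>\<close> or \<open>p = -\<i>\<close>.\<close>

lemma isotropic_invariant_kernel:
  fixes J :: "real^'n::finite \<Rightarrow> real^'n"
  assumes J: "orthogonal_complex J" and A: "linear A" "surj A" and iso: "pairing A A = 0"
    and ker: "\<And>v. A v = 0 \<Longrightarrow> A (J v) = 0"
  shows "(\<forall>v. A (J v) = \<i> * A v) \<or> (\<forall>v. A (J v) = - \<i> * A v)"
proof -
  interpret orthogonal_complex J by fact
  obtain v1 v2 where v1: "A v1 = 1" and v2: "A v2 = \<i>"
    using A(2) unfolding surj_def by metis
  \<comment> \<open>The complex linear and conjugate linear parts of the induced map on the complex
    plane, read off from its values at \<open>1\<close> and \<open>\<i>\<close>.\<close>
  define p r where "p = (A (J v1) - \<i> * A (J v2)) / 2" and "r = (A (J v1) + \<i> * A (J v2)) / 2"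
  have AJ: "A (J v) = p * A v + r * cnj (A v)" for v
  proof -
    have "A (v - Re (A v) *\<^sub>R v1 - Im (A v) *\<^sub>R v2) = 0"
      by (simp add: linear_diff[OF A(1)] linear_cmul[OF A(1)] v1 v2 complex_eq_iff)
    from ker[OF this] have "A (J v) = of_real (Re (A v)) * A (J v1) + of_real (Im (A v)) * A (J v2)"
      by (simp add: linear_diff[OF A(1)] linear_cmul[OF A(1)] linear_diff[OF linear_J]
          linear_cmul[OF linear_J]) (simp add: complex_eq_iff)
    also have "\<dots> = p * A v + r * cnj (A v)"
      by (simp add: p_def r_def complex_eq_iff field_simps)
    finally show ?thesis .
  qed
  have sq: "- A v = p * (p * A v + r * cnj (A v)) + r * cnj (p * A v + r * cnj (A v))" for v
    using AJ[of "J v"] AJ[of v] square[of v] linear_neg[OF A(1)] by simp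
  have e1: "p * p + r * cnj r = -1"
    using sq[of v1] sq[of v2] v1 v2 by (simp add: complex_eq_iff) (auto simp: algebra_simps)
  \<comment> \<open>Composition with \<open>J\<close> preserves the pairing, so this covector is
    isotropic too; in the expansion only the mixed term with \<open>2 * p * r\<close>
    survives.\<close>
  have "pairing (\<lambda>v. A (J v)) (\<lambda>v. A (J v)) = - pairing A (\<lambda>v. A (J (J v)))"
    using pairing_skew[OF J A(1) linear_compose[OF linear_J A(1)]] by (simp add: o_def)
  also have "\<dots> = 0"
    using iso by (simp add: pairing_def square linear_neg[OF A(1)] sum_negf)
  finally have "0 = (\<Sum>i\<in>UNIV. (p * A (axis i 1) + r * cnj (A (axis i 1)))\<^sup>2)"
    by (simp add: pairing_def AJ power2_eq_square)
  also have "\<dots> = p\<^sup>2 * pairing A A + r\<^sup>2 * cnj (pairing A A)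
      + 2 * p * r * (\<Sum>i\<in>UNIV. A (axis i 1) * cnj (A (axis i 1)))"
    by (simp add: pairing_def sum_distrib_left sum.distrib[symmetric] power2_eq_square algebra_simps)
  also have "(\<Sum>i\<in>UNIV. A (axis i 1) * cnj (A (axis i 1))) = of_real (\<Sum>i\<in>UNIV. (norm (A (axis i 1)))\<^sup>2)"
    by (simp add: complex_norm_square del: of_real_power)
  finally have "p * r * of_real (\<Sum>i\<in>UNIV. (norm (A (axis i 1)))\<^sup>2) = 0"
    using iso by simp
  moreover have "(\<Sum>i\<in>UNIV. (norm (A (axis i 1)))\<^sup>2) \<noteq> 0"
  proof
    assume "(\<Sum>i\<in>UNIV. (norm (A (axis i 1)))\<^sup>2) = 0"
    then have "A (axis i 1) = 0" for i
      by (subst (asm) sum_nonneg_eq_0_iff) auto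
    then show False using linear_axis_expansion[OF A(1), of v1] v1 by simp
  qed
  ultimately have "p = 0 \<or> r = 0" by (metis mult_eq_0_iff of_real_eq_0_iff)
  moreover have "p \<noteq> 0"
  proof
    assume "p = 0"
    then have "of_real ((norm r)\<^sup>2) = (-1 :: complex)" using e1 by (simp add: complex_norm_square del: of_real_power)
    then have "(norm r)\<^sup>2 = -1" by (metis of_real_eq_iff of_real_minus of_real_1)
    then show False by (metis zero_le_power2 neg_0_le_iff_le not_one_le_zero)
  qed
  ultimately have "r = 0" by blast
  then have "(p - \<i>) * (p + \<i>) = 0" using e1 by (simp add: algebra_simps)
  then have "p = \<i> \<or> p = - \<i>" by (auto simp: eq_neg_iff_add_eq_0)
  then show ?thesis using AJ \<open>r = 0\<close> by auto
qed

section \<open>Holomorphic harmonic functions\<close>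

definition laplacian :: "(real^'n::finite \<Rightarrow> complex) \<Rightarrow> real^'n \<Rightarrow> complex" where
  "laplacian f x = (\<Sum>i\<in>UNIV. partial (partial f i) i x)"

text \<open>For almost Hermitian \<open>J\<close> this class is closed under sums, products and
  reciprocals, so every rational expression in known members is a harmonic morphism where it is
  defined.\<close>

definition holomorphic_harmonic ::
    "(real^'n::finite) set \<Rightarrow> (real^'n \<Rightarrow> real^'n \<Rightarrow> real^'n) \<Rightarrow> (real^'n \<Rightarrow> complex) \<Rightarrow> bool" where
  "holomorphic_harmonic U J f \<longleftrightarrow>
     smooth_on U f \<and> holomorphic_wrt U J f \<and> (\<forall>x\<in>U. laplacian f x = 0)"

section \<open>Product rules for partial derivatives and the Laplacian\<close>

lemma partial_eq: "(f has_derivative f') (at x) \<Longrightarrow> partial f i x = f' (axis i 1)"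
  unfolding partial_def using frechet_derivative_at by metis

lemma smooth_on_partial: "smooth_on S f \<Longrightarrow> smooth_on S (partial f i)"
  unfolding partial_def[abs_def] by (rule smooth_on_frechet_derivative)

lemma partial_cong:
  assumes "open S" "x \<in> S" "smooth_on S f" "\<And>y. y \<in> S \<Longrightarrow> f y = g y"
  shows "partial f i x = partial g i x"
  using partial_eq[OF has_derivative_transform_within_open[OF smooth_on_D(2)[OF assms(3,2)] assms(1,2,4)]]
  by (simp add: partial_def)

lemma partial_add:
  "smooth_on S f \<Longrightarrow> smooth_on S g \<Longrightarrow> x \<in> S \<Longrightarrow>
    partial (\<lambda>x. f x + g x) i x = partial f i x + partial g i x"
  by (subst partial_eq[OF has_derivative_add[OF smooth_on_D(2) smooth_on_D(2)]])
    (assumption | simp add: partial_def)+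

lemma partial_mult:
  fixes f g :: "real^'n::finite \<Rightarrow> complex"
  shows "smooth_on S f \<Longrightarrow> smooth_on S g \<Longrightarrow> x \<in> S \<Longrightarrow>
    partial (\<lambda>x. f x * g x) i x = f x * partial g i x + partial f i x * g x"
  by (subst partial_eq[OF has_derivative_mult[OF smooth_on_D(2) smooth_on_D(2)]])
    (assumption | simp add: partial_def)+

lemma laplacian_add:
  assumes "open S" "smooth_on S f" "smooth_on S g" "x \<in> S"
  shows "laplacian (\<lambda>x. f x + g x) x = laplacian f x + laplacian g x"
proof -
  have "partial (partial (\<lambda>x. f x + g x) i) i x = partial (\<lambda>x. partial f i x + partial g i x) i x" for i
    by (rule partial_cong[OF assms(1,4)])
      (simp_all add: assms smooth_on_partial smooth_on_add partial_add[of S])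
  then show ?thesis
    using assms by (simp add: laplacian_def partial_add[of S] smooth_on_partial sum.distrib)
qed

lemma laplacian_mult:
  assumes "open S" "smooth_on S f" "smooth_on S g" "x \<in> S"
  shows "laplacian (\<lambda>x. f x * g x) x =
    f x * laplacian g x + g x * laplacian f x + 2 * pairing (FD f x) (FD g x)"
proof -
  have "partial (partial (\<lambda>x. f x * g x) i) i x =
      partial (\<lambda>x. f x * partial g i x + partial f i x * g x) i x" for i
    by (rule partial_cong[OF assms(1,4)])
      (simp_all add: assms smooth_on_partial smooth_on_mult partial_mult[of S])
  also have "\<dots> i = f x * partial (partial g i) i x + g x * partial (partial f i) i x
      + 2 * (partial f i x * partial g i x)" for i
    using assms by (simp add: partial_add[of S] partial_mult[of S] smooth_on_mult smooth_on_partial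
        algebra_simps)
  finally show ?thesis
    by (simp add: laplacian_def pairing_def partial_def sum.distrib sum_distrib_left)
qed

lemma laplacian_const: "laplacian (\<lambda>x. c) (x :: real^'n::finite) = 0"
proof -
  have "partial (\<lambda>x. d) i = (\<lambda>x. 0)" for d :: complex and i :: 'n
    by (simp add: partial_def[abs_def] frechet_derivative_const)
  then show ?thesis by (simp add: laplacian_def)
qed

lemma laplacian_bounded_linear:
  assumes "bounded_linear h"
  shows "laplacian h x = 0"
proof -
  have "partial h i = (\<lambda>x. h (axis i 1))" for i
    using partial_eq[OF bounded_linear_imp_has_derivative[OF assms]] by blast
  then show ?thesis
    by (simp add: laplacian_def partial_def frechet_derivative_const)
qed

lemma holomorphic_wrt_at:
  assumes "holomorphic_wrt U J f" "x \<in> U"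
  shows "linear (FD f x)" "FD f x (J x v) = \<i> * FD f x v"
  using assms linear_frechet_derivative by (auto simp: holomorphic_wrt_def)

text \<open>Both differentials lie in the \<open>\<i>\<close>-eigenspace of \<open>J x\<close>. For
  products this kills the cross term of the Laplacian; for \<open>f = g\<close> it is the
  conformality equation.\<close>

lemma holomorphic_pairing:
  assumes "almost_hermitian_structure U J" "holomorphic_wrt U J f" "holomorphic_wrt U J g" "x \<in> U"
  shows "pairing (FD f x) (FD g x) = 0"
  using pairing_zero[OF almost_hermitian_orthogonal_complex[OF assms(1,4)]
      holomorphic_wrt_at(1)[OF assms(2,4)] holomorphic_wrt_at(1)[OF assms(3,4)], of \<i>]
    holomorphic_wrt_at(2)[OF assms(2,4)] holomorphic_wrt_at(2)[OF assms(3,4)] by simp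

lemma holomorphic_wrtI:
  assumes "\<And>x. x \<in> U \<Longrightarrow> (f has_derivative f' x) (at x)"
    and "\<And>x v. x \<in> U \<Longrightarrow> f' x (J x v) = \<i> * f' x v"
  shows "holomorphic_wrt U J f"
  using assms frechet_derivative_at[OF assms(1)]
  by (auto simp: holomorphic_wrt_def differentiable_def)

lemma holomorphic_harmonic_const: "holomorphic_harmonic U J (\<lambda>x. c)"
  by (auto simp: holomorphic_harmonic_def smooth_on_const laplacian_const
      intro!: holomorphic_wrtI has_derivative_const)

lemma holomorphic_harmonic_add:
  assumes "open U" "holomorphic_harmonic U J f" "holomorphic_harmonic U J g"
  shows "holomorphic_harmonic U J (\<lambda>x. f x + g x)"
  unfolding holomorphic_harmonic_def
proof (intro conjI ballI)
  note f = assms(2)[unfolded holomorphic_harmonic_def] and g = assms(3)[unfolded holomorphic_harmonic_def]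
  show "smooth_on U (\<lambda>x. f x + g x)" using assms(1) f g by (simp add: smooth_on_add)
  show "laplacian (\<lambda>x. f x + g x) x = 0" if "x \<in> U" for x
    using f g that laplacian_add[OF assms(1)] by simp
  show "holomorphic_wrt U J (\<lambda>x. f x + g x)"
    by (rule holomorphic_wrtI[OF has_derivative_add[OF smooth_on_D(2) smooth_on_D(2)]])
      (use f g in \<open>auto simp: holomorphic_wrt_at(2)[of U J] algebra_simps\<close>)
qed

lemma holomorphic_harmonic_mult:
  assumes "open U" "almost_hermitian_structure U J"
    and "holomorphic_harmonic U J f" "holomorphic_harmonic U J g"
  shows "holomorphic_harmonic U J (\<lambda>x. f x * g x)"
  unfolding holomorphic_harmonic_def
proof (intro conjI ballI)
  note f = assms(3)[unfolded holomorphic_harmonic_def] and g = assms(4)[unfolded holomorphic_harmonic_def]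
  show "smooth_on U (\<lambda>x. f x * g x)" using assms(1) f g by (simp add: smooth_on_mult)
  show "laplacian (\<lambda>x. f x * g x) x = 0" if "x \<in> U" for x
    using f g that laplacian_mult[OF assms(1)] holomorphic_pairing[OF assms(2)] by simp
  show "holomorphic_wrt U J (\<lambda>x. f x * g x)"
    by (rule holomorphic_wrtI[OF has_derivative_mult[OF smooth_on_D(2) smooth_on_D(2)]])
      (use f g in \<open>auto simp: holomorphic_wrt_at(2)[of U J] algebra_simps\<close>)
qed

lemma holomorphic_harmonic_sum:
  "open U \<Longrightarrow> (\<And>i. i \<in> I \<Longrightarrow> holomorphic_harmonic U J (f i))
    \<Longrightarrow> holomorphic_harmonic U J (\<lambda>x. \<Sum>i\<in>I. f i x)"
  by (induction I rule: infinite_finite_induct)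
    (simp_all add: holomorphic_harmonic_const holomorphic_harmonic_add)

text \<open>The Laplacian of the reciprocal follows from the product rule for
  \<open>f x * inverse (f x) = 1\<close>, whose cross term vanishes by holomorphy.\<close>

lemma holomorphic_harmonic_inverse:
  assumes "open U" "almost_hermitian_structure U J"
    and "holomorphic_harmonic U J f" "\<And>x. x \<in> U \<Longrightarrow> f x \<noteq> 0"
  shows "holomorphic_harmonic U J (\<lambda>x. inverse (f x))"
proof -
  note f = assms(3)[unfolded holomorphic_harmonic_def]
  let ?h = "\<lambda>x. inverse (f x)"
  have s: "smooth_on U ?h" using assms(1,4) f by (simp add: smooth_on_inverse)
  have h: "holomorphic_wrt U J ?h"
    by (rule holomorphic_wrtI[OF Deriv.has_derivative_inverse[OF _ smooth_on_D(2)]])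
      (use f assms(4) in \<open>auto simp: holomorphic_wrt_at(2)[of U J] algebra_simps\<close>)
  have "laplacian ?h x = 0" if x: "x \<in> U" for x
  proof -
    \<comment> \<open>The product equals 1 only on \<open>U\<close>, so the first and then the
      second derivatives are compared on that open set.\<close>
    have "partial (partial (\<lambda>x. f x * ?h x) i) i x = partial (partial (\<lambda>x. 1) i) i x" for i
    proof (rule partial_cong[OF assms(1) x])
      show "smooth_on U (partial (\<lambda>x. f x * ?h x) i)"
        using assms(1) f s by (simp add: smooth_on_partial smooth_on_mult)
      show "partial (\<lambda>x. f x * ?h x) i y = partial (\<lambda>x. 1) i y" if "y \<in> U" for y
        by (rule partial_cong[OF assms(1) that]) (use assms f s in \<open>auto simp: smooth_on_mult\<close>)
    qed
    then have "laplacian (\<lambda>x. f x * ?h x) x = 0"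
      using laplacian_const[of 1 x] by (simp add: laplacian_def)
    then show ?thesis
      using laplacian_mult[OF assms(1) _ s x, of f] f x assms(4) holomorphic_pairing[OF assms(2) _ h x]
      by simp
  qed
  with s h show ?thesis by (simp add: holomorphic_harmonic_def)
qed

lemma harmonic_morphism_if_holomorphic_harmonic:
  assumes "open U" "almost_hermitian_structure U J" "holomorphic_harmonic U J f"
  shows "harmonic_morphism U f"
proof -
  have "(\<Sum>i\<in>UNIV. (partial f i x)\<^sup>2) = 0" if "x \<in> U" for x
    using holomorphic_pairing[OF assms(2) _ _ that, of f f] assms(3)
    by (simp add: holomorphic_harmonic_def pairing_def partial_def power2_eq_square)
  then show ?thesis
    using assms by (simp add: harmonic_morphism_def holomorphic_harmonic_def laplacian_def)
qed

section \<open>Curves, fullness and superminimality\<close>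

lemma constant_along_curve:
  fixes f :: "'a::real_normed_vector \<Rightarrow> 'b::real_normed_vector" and T :: "real set"
  assumes "convex T" "s \<in> T" "t \<in> T"
    and "\<And>t. t \<in> T \<Longrightarrow> (\<gamma> has_vector_derivative \<gamma>' t) (at t)"
    and "\<And>t. t \<in> T \<Longrightarrow> f differentiable at (\<gamma> t)"
    and "\<And>t. t \<in> T \<Longrightarrow> FD f (\<gamma> t) (\<gamma>' t) = 0"
  shows "f (\<gamma> s) = f (\<gamma> t)"
proof -
  have "((\<lambda>t. f (\<gamma> t)) has_derivative (\<lambda>h. 0)) (at t within T)" if t: "t \<in> T" for t
  proof -
    have "(\<gamma> has_derivative (\<lambda>h. h *\<^sub>R \<gamma>' t)) (at t)"
      using assms(4)[OF t] by (simp add: has_vector_derivative_def)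
    moreover have f: "(f has_derivative FD f (\<gamma> t)) (at (\<gamma> t))"
      using assms(5)[OF t] by (simp add: frechet_derivative_works)
    ultimately have "(f \<circ> \<gamma> has_derivative FD f (\<gamma> t) \<circ> (\<lambda>h. h *\<^sub>R \<gamma>' t)) (at t)"
      by (rule diff_chain_at)
    also have "FD f (\<gamma> t) \<circ> (\<lambda>h. h *\<^sub>R \<gamma>' t) = (\<lambda>h. 0)"
      using assms(6)[OF t] linear_cmul[OF has_derivative_linear[OF f]] by (simp add: fun_eq_iff)
    finally show ?thesis by (simp add: o_def has_derivative_at_withinI)
  qed
  then obtain c where "\<And>t. t \<in> T \<Longrightarrow> f (\<gamma> t) = c"
    using has_derivative_zero_constant[OF assms(1), of "\<lambda>t. f (\<gamma> t)"] by blast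
  then show ?thesis using assms(2,3) by simp
qed

lemma derivative_along_constant_curve:
  assumes "(\<gamma> has_vector_derivative v) (at 0)" "\<epsilon> > 0" "f differentiable at (\<gamma> 0)"
    and "\<And>t. \<bar>t\<bar> < \<epsilon> \<Longrightarrow> f (\<gamma> t) = f (\<gamma> 0)"
  shows "FD f (\<gamma> 0) v = 0"
proof -
  have "(f \<circ> \<gamma> has_derivative FD f (\<gamma> 0) \<circ> (\<lambda>h. h *\<^sub>R v)) (at 0)"
    using assms(1,3) by (intro diff_chain_at)
      (simp_all add: has_vector_derivative_def frechet_derivative_works[symmetric])
  moreover have "(f \<circ> \<gamma> has_derivative (\<lambda>h. 0)) (at 0)"
  proof (rule has_derivative_transform_within_open[OF has_derivative_const])
    show "f (\<gamma> 0) = (f \<circ> \<gamma>) t" if "t \<in> ball 0 \<epsilon>" for t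
      using assms(4)[of t] that by (simp add: dist_norm)
  qed (use assms(2) in auto)
  ultimately have "FD f (\<gamma> 0) \<circ> (\<lambda>h. h *\<^sub>R v) = (\<lambda>h. 0)"
    by (rule has_derivative_unique)
  from fun_cong[OF this, of 1] show ?thesis by simp
qed

lemma line_has_vector_derivative: "((\<lambda>t. x + t *\<^sub>R v) has_vector_derivative v) (at t)"
  by (auto intro!: derivative_eq_intros)

lemma line_in_open:
  fixes x v :: "'a::real_normed_vector"
  assumes "open U" "x \<in> U"
  obtains \<epsilon> :: real where "\<epsilon> > 0" "\<And>t. \<bar>t\<bar> < \<epsilon> \<Longrightarrow> x + t *\<^sub>R v \<in> U"
proof -
  have "open ((\<lambda>t::real. x + t *\<^sub>R v) -` U)"
    by (intro open_vimage assms continuous_intros)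
  then obtain \<epsilon> :: real where "\<epsilon> > 0" "ball 0 \<epsilon> \<subseteq> (\<lambda>t. x + t *\<^sub>R v) -` U"
    using assms(2) unfolding open_contains_ball by force
  then show ?thesis using that[of \<epsilon>] by (auto simp: subset_iff)
qed

text \<open>A function that factors through the projection onto a proper subspace is constant along
  short segments normal to the subspace, so its differential kills a normal vector throughout
  \<open>U\<close>.\<close>

lemma full_onI:
  assumes "open U" "\<And>x. x \<in> U \<Longrightarrow> \<phi> differentiable at x"
    and "\<And>v. (\<And>x. x \<in> U \<Longrightarrow> FD \<phi> x v = 0) \<Longrightarrow> v = 0"
  shows "full_on U \<phi>"
  unfolding full_on_def
proof (intro notI, elim exE conjE)
  fix A :: "'a set" and \<pi> and \<psi> :: "'a \<Rightarrow> complex"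
  assume A: "subspace A" "A \<noteq> UNIV" and \<pi>: "orthogonal_projection_onto A \<pi>"
    and \<phi>: "\<forall>x\<in>U. \<phi> x = \<psi> (\<pi> x)"
  have "span A \<noteq> UNIV" using A by (simp add: span_eq_iff[THEN iffD2])
  then have "dim A < DIM('a)"
    using dim_subset_UNIV[of A] dim_eq_full[of A] by linarith
  then obtain v where "v \<noteq> 0" and v: "\<And>y. y \<in> A \<Longrightarrow> v \<bullet> y = 0"
    using orthogonal_to_subspace_exists[of A] span_base unfolding orthogonal_def by metis
  \<comment> \<open>Only the defining property of a projection is available: the difference of the
    two projections lies in \<open>A\<close> and is orthogonal to \<open>A\<close>, hence to
    itself.\<close>
  have inv: "\<pi> (x + t *\<^sub>R v) = \<pi> x" for x t
  proof -
    let ?d = "\<pi> (x + t *\<^sub>R v) - \<pi> x"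
    have P: "\<pi> y \<in> A" "a \<in> A \<Longrightarrow> (y - \<pi> y) \<bullet> a = 0" for y a
      using \<pi> by (auto simp: orthogonal_projection_onto_def orthogonal_def)
    have d: "?d \<in> A" using P(1) A(1) subspace_diff by blast
    have "?d \<bullet> ?d = (x - \<pi> x) \<bullet> ?d - (x + t *\<^sub>R v - \<pi> (x + t *\<^sub>R v)) \<bullet> ?d + t * (v \<bullet> ?d)"
      by (simp add: inner_diff_left inner_add_left)
    also have "\<dots> = 0" using P(2)[OF d] v[OF d] by simp
    finally show ?thesis by simp
  qed
  have "v = 0"
  proof (rule assms(3))
    fix x assume x: "x \<in> U"
    obtain \<epsilon> :: real where \<epsilon>: "\<epsilon> > 0" "\<And>t. \<bar>t\<bar> < \<epsilon> \<Longrightarrow> x + t *\<^sub>R v \<in> U"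
      using line_in_open[OF assms(1) x] by blast
    show "FD \<phi> x v = 0"
      using derivative_along_constant_curve[OF line_has_vector_derivative \<epsilon>(1), of \<phi> x v]
        \<epsilon>(2) inv \<phi> x assms(2) by simp
  qed
  with \<open>v \<noteq> 0\<close> show False by blast
qed

section \<open>Tangent spaces of fibres and superminimality\<close>

lemma tangent_vectors_kernel:
  assumes "v \<in> tangent_vectors {y\<in>U. \<phi> y = c} x" "\<phi> differentiable at x"
  shows "FD \<phi> x v = 0"
proof -
  obtain \<gamma> \<epsilon> where "\<epsilon> > 0" "\<gamma> 0 = x" "\<And>t. \<bar>t\<bar> < \<epsilon> \<Longrightarrow> \<gamma> t \<in> {y\<in>U. \<phi> y = c}"
    "(\<gamma> has_vector_derivative v) (at 0)"
    using assms(1) unfolding tangent_vectors_def by blast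
  then show ?thesis
    using derivative_along_constant_curve[of \<gamma> v \<epsilon> \<phi>] assms(2) by fastforce
qed

text \<open>The map \<open>R\<close> sends a short segment through \<open>x\<close> in direction
  \<open>v\<close> to a curve in \<open>S\<close>, whose velocity is
  \<open>R' v = v\<close>.\<close>

lemma tangent_vectors_retraction:
  assumes "open W" "x \<in> W" "\<And>y. y \<in> W \<Longrightarrow> R y \<in> S" "R x = x"
    and "(R has_derivative R') (at x)" "R' v = v"
  shows "v \<in> tangent_vectors S x"
proof -
  obtain \<epsilon> :: real where \<epsilon>: "\<epsilon> > 0" "\<And>t. \<bar>t\<bar> < \<epsilon> \<Longrightarrow> x + t *\<^sub>R v \<in> W"
    using line_in_open[OF assms(1,2)] by blast
  have "(R has_derivative R') (at (x + 0 *\<^sub>R v))"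
    using assms(5) by simp
  then have "(R \<circ> (\<lambda>t. x + t *\<^sub>R v) has_vector_derivative v) (at 0)"
    using diff_chain_at[OF line_has_vector_derivative[unfolded has_vector_derivative_def], of R R' x 0 v]
      linear_cmul[OF has_derivative_linear[OF assms(5)]] assms(6)
    by (simp add: has_vector_derivative_def o_def)
  then show ?thesis
    unfolding tangent_vectors_def using \<epsilon> assms(3,4)
    by (intro CollectI exI[of _ "R \<circ> (\<lambda>t. x + t *\<^sub>R v)"] exI[of _ \<epsilon>]) auto
qed

text \<open>The image contains \<open>A u\<close> and \<open>\<i> * A u\<close>, which span the
  plane over the reals.\<close>

lemma surj_if_complex_linear:
  fixes A :: "'a::real_vector \<Rightarrow> complex"
  assumes "linear A" "\<And>v. A (J v) = \<i> * A v" "A u \<noteq> 0"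
  shows "surj A"
proof (rule surjI)
  fix z
  show "A (Re (z / A u) *\<^sub>R u + Im (z / A u) *\<^sub>R J u) = z"
  proof -
    have "A (Re (z / A u) *\<^sub>R u + Im (z / A u) *\<^sub>R J u)
        = (of_real (Re (z / A u)) + \<i> * of_real (Im (z / A u))) * A u"
      by (simp add: linear_add[OF assms(1)] linear_cmul[OF assms(1)] assms(2) scaleR_conv_of_real
          algebra_simps)
    also have "\<dots> = z" using assms(3) by (simp flip: complex_eq)
    finally show ?thesis .
  qed
qed

text \<open>The tangent spaces of the fibres are the kernels of the differential:
  \<open>tangent_vectors_kernel\<close> gives one inclusion and \<open>ker\<close> the other.
  Kernels are invariant under \<open>J\<close> by holomorphy, and a structure that is constant on
  each fibre has zero derivative along curves inside it.\<close>

lemma superminimal_fibresI: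
  fixes \<phi> :: "'a::euclidean_space \<Rightarrow> complex"
  assumes "even DIM('a)" "DIM('a) \<ge> 2" and U: "open U"
    and J: "almost_hermitian_structure U J"
    and \<phi>: "smooth_on U \<phi>" "submersive_on U \<phi>" "holomorphic_wrt U J \<phi>"
    and ker: "\<And>x v. x \<in> U \<Longrightarrow> FD \<phi> x v = 0 \<Longrightarrow> v \<in> tangent_vectors {y\<in>U. \<phi> y = \<phi> x} x"
    and const: "\<And>x y. x \<in> U \<Longrightarrow> y \<in> U \<Longrightarrow> \<phi> x = \<phi> y \<Longrightarrow> J x = J y"
  shows "superminimal_fibres U J \<phi>"
  unfolding superminimal_fibres_def superminimal_def
proof (intro ballI conjI allI)
  fix c
  let ?S = "{x\<in>U. \<phi> x = c}"
  show "?S \<subseteq> U" by blast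
  have codim: "DIM('a) - (DIM('a) - 2) = 2" using assms(2) by simp
  \<comment> \<open>The two defining equations of a fibre of codimension two. Only indices 0 and 1
    matter; every larger one repeats the imaginary part.\<close>
  let ?F = "\<lambda>i::nat. if i = 0 then (\<lambda>y. Re (\<phi> y - c)) else (\<lambda>y. Im (\<phi> y - c))"
  have d: "(\<phi> has_derivative FD \<phi> x) (at x)" if "x \<in> U" for x
    using \<phi>(1) that by (rule smooth_on_D)
  have s: "smooth_on U (?F i)" for i
    using \<phi>(1) U by (auto intro!: smooth_on_linear_compose[OF _ bounded_linear_Re]
        smooth_on_linear_compose[OF _ bounded_linear_Im] smooth_on_diff smooth_on_const)
  have fd: "FD (?F i) x = (if i = 0 then (\<lambda>v. Re (FD \<phi> x v)) else (\<lambda>v. Im (FD \<phi> x v)))" if "x \<in> U" for i x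
  proof -
    have "(?F i has_derivative (if i = 0 then (\<lambda>v. Re (FD \<phi> x v)) else (\<lambda>v. Im (FD \<phi> x v)))) (at x)"
      using d[OF that] by (auto intro!: derivative_eq_intros)
    from frechet_derivative_at[OF this] show ?thesis by (rule sym)
  qed
  have "\<exists>v. \<forall>i<2. FD (?F i) y v = b i" if "y \<in> U" for y and b :: "nat \<Rightarrow> real"
  proof -
    have "surj (FD \<phi> y)"
      using \<phi>(2) that by (simp add: submersive_on_def)
    from surjD[OF this] obtain v where "Complex (b 0) (b 1) = FD \<phi> y v"
      by blast
    from this[symmetric]
    have "\<forall>i<2. FD (?F i) y v = b i"
      using that by (auto simp: fd less_2_cases_iff)
    then show ?thesis ..
  qed
  moreover have "?S \<inter> U = {y\<in>U. \<forall>i<2. ?F i y = 0}"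
    by (auto simp: complex_eq_iff less_2_cases_iff dest: spec[of _ 0] spec[of _ 1])
  ultimately have "submanifold (DIM('a) - 2) ?S"
    unfolding submanifold_def codim
    by (intro conjI ballI exI[of _ U] exI[of _ ?F]) (use U s in auto)
  moreover have "even (DIM('a) - 2)" using assms(1) by simp
  ultimately show "\<exists>d. even d \<and> submanifold d ?S" by blast
  show "adapted_to J ?S"
    unfolding adapted_to_def
  proof (intro ballI)
    fix x v assume x: "x \<in> ?S" and v: "v \<in> tangent_vectors ?S x"
    have "FD \<phi> x v = 0" using tangent_vectors_kernel[OF v] d x differentiable_def by blast
    then have "FD \<phi> x (J x v) = 0" using holomorphic_wrt_at(2)[OF \<phi>(3)] x by simp
    then show "J x v \<in> tangent_vectors ?S x" using ker[of x] x by auto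
  qed
  fix x v w assume x: "x \<in> ?S" and v: "v \<in> tangent_vectors ?S x"
  obtain \<gamma> \<epsilon> where \<gamma>: "\<epsilon> > 0" "\<gamma> 0 = x" "\<And>t. \<bar>t\<bar> < \<epsilon> \<Longrightarrow> \<gamma> t \<in> ?S"
    "(\<gamma> has_vector_derivative v) (at 0)"
    using v unfolding tangent_vectors_def by blast
  have "smooth_on U (\<lambda>y. J y w)" using J by (simp add: almost_hermitian_structure_def)
  from smooth_on_D(1)[OF this] x
  have "(\<lambda>y. J y w) differentiable at (\<gamma> 0)" using \<gamma>(2) by simp
  moreover have "J (\<gamma> t) w = J (\<gamma> 0) w" if "\<bar>t\<bar> < \<epsilon>" for t
    using const[of "\<gamma> t" x] \<gamma>(2) \<gamma>(3)[OF that] x by simp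
  ultimately have "FD (\<lambda>y. J y w) (\<gamma> 0) v = 0"
    by (intro derivative_along_constant_curve[OF \<gamma>(4,1)])
  then show "FD (\<lambda>y. J y w) x v = 0" using \<gamma>(2) by simp
qed

section \<open>Constancy of complex structures along curves\<close>

lemma almost_hermitian_differentiable:
  "almost_hermitian_structure U J \<Longrightarrow> x \<in> U \<Longrightarrow> (\<lambda>y. J y w) differentiable at x"
  unfolding almost_hermitian_structure_def using smooth_on_D(1) by blast

text \<open>\<open>K\<close> does not change along the curve, so the differentials at both ends are
  eigencovectors of a single orthogonal complex structure. A nonzero pairing at two such points
  excludes every Kaehler structure.\<close>

lemma kaehler_holomorphic_pairing:
  assumes K: "kaehler_structure U K" "holomorphic_wrt U K \<phi>"
    and "\<And>t. t \<in> {0..1} \<Longrightarrow> (\<gamma> has_vector_derivative \<gamma>' t) (at t)"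
    and in_U: "\<And>t. t \<in> {0..1} \<Longrightarrow> \<gamma> t \<in> U"
  shows "pairing (FD \<phi> (\<gamma> 0)) (FD \<phi> (\<gamma> 1)) = 0"
proof -
  have H: "almost_hermitian_structure U K" using K(1) by (simp add: kaehler_structure_def)
  have "K (\<gamma> 0) w = K (\<gamma> 1) w" for w
    by (rule constant_along_curve[where f = "\<lambda>y. K y w" and T = "{0..1}", OF _ _ _ assms(3)])
      (use K(1) in_U almost_hermitian_differentiable[OF H] in \<open>auto simp: kaehler_structure_def\<close>)
  then show ?thesis
    using pairing_zero[OF almost_hermitian_orthogonal_complex[OF H in_U[of 0]], of _ _ \<i>]
      holomorphic_wrt_at[OF K(2) in_U[of 0]] holomorphic_wrt_at[OF K(2) in_U[of 1]] by simp
qed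

lemma superminimal_constant_on_line:
  assumes "almost_hermitian_structure U J" "superminimal U J S"
    and "\<And>t. x + t *\<^sub>R e \<in> S"
  shows "J (x + s *\<^sub>R e) w = J (x + t *\<^sub>R e) w"
proof (rule constant_along_curve[where f = "\<lambda>y. J y w" and T = UNIV, OF _ _ _ line_has_vector_derivative])
  fix t
  have "e \<in> tangent_vectors S (x + t *\<^sub>R e)"
    unfolding tangent_vectors_def
  proof (intro CollectI exI[of _ 1] exI conjI allI impI)
    show "((\<lambda>r. (x + t *\<^sub>R e) + r *\<^sub>R e) has_vector_derivative e) (at 0)"
      by (rule line_has_vector_derivative)
    show "(x + t *\<^sub>R e) + r *\<^sub>R e \<in> S" for r
      using assms(3)[of "t + r"] by (simp add: algebra_simps)
  qed (use zero_less_one in auto)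
  then show "FD (\<lambda>y. J y w) (x + t *\<^sub>R e) e = 0"
    using assms(2,3) by (auto simp: superminimal_def)
  show "(\<lambda>y. J y w) differentiable at (x + t *\<^sub>R e)"
    using almost_hermitian_differentiable[OF assms(1)] assms(2,3) by (auto simp: superminimal_def)
qed auto

text \<open>On a line in a superminimal fibre the structure is constant and acts on each covector as
  \<open>\<i>\<close> or as \<open>-\<i>\<close>. Two of any three points share the sign, so their covectors lie in
  a common isotropic eigenspace.\<close>

lemma superminimal_line_pairing:
  fixes \<phi> :: "real^'n::finite \<Rightarrow> complex" and x e :: "real^'n"
  assumes J: "almost_hermitian_structure U J"
    and S: "superminimal U J {y\<in>U. \<phi> y = c}"
    and line: "\<And>t. x + t *\<^sub>R e \<in> U" "\<And>t. \<phi> (x + t *\<^sub>R e) = c"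
    and \<phi>: "harmonic_morphism U \<phi>" "submersive_on U \<phi>"
    and ker: "\<And>t v. FD \<phi> (x + t *\<^sub>R e) v = 0
      \<Longrightarrow> v \<in> tangent_vectors {y\<in>U. \<phi> y = c} (x + t *\<^sub>R e)"
  shows "\<exists>s\<in>{0,1,2}. \<exists>t\<in>{0,1,2}. s \<noteq> t \<and>
    pairing (FD \<phi> (x + s *\<^sub>R e)) (FD \<phi> (x + t *\<^sub>R e)) = 0"
proof -
  let ?p = "\<lambda>t. x + t *\<^sub>R e" and ?S = "{y\<in>U. \<phi> y = c}"
  have diff: "\<phi> differentiable at (?p t)" for t
    using \<phi>(2) line by (simp add: submersive_on_def)
  have lin: "linear (FD \<phi> (?p t))" for t
    using diff linear_frechet_derivative by blast
  have J0: "J (?p t) = J (?p 0)" for t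
    using superminimal_constant_on_line[OF J S, of x e t _ 0] line by (auto simp: fun_eq_iff)
  have oc: "orthogonal_complex (J (?p 0))"
    using almost_hermitian_orthogonal_complex[OF J line(1)] .
  have sign: "(\<forall>v. FD \<phi> (?p t) (J (?p 0) v) = \<i> * FD \<phi> (?p t) v)
      \<or> (\<forall>v. FD \<phi> (?p t) (J (?p 0) v) = - \<i> * FD \<phi> (?p t) v)" for t
  proof (rule isotropic_invariant_kernel[OF oc lin])
    show "surj (FD \<phi> (?p t))" using \<phi>(2) line by (simp add: submersive_on_def)
    show "pairing (FD \<phi> (?p t)) (FD \<phi> (?p t)) = 0"
      using \<phi>(1) line(1) by (simp add: harmonic_morphism_def pairing_def partial_def power2_eq_square)
    fix v assume "FD \<phi> (?p t) v = 0"
    then have "J (?p t) v \<in> tangent_vectors ?S (?p t)"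
      using S ker line by (auto simp: superminimal_def adapted_to_def)
    then show "FD \<phi> (?p t) (J (?p 0) v) = 0"
      using tangent_vectors_kernel diff J0 by metis
  qed
  have z: "pairing (FD \<phi> (?p s)) (FD \<phi> (?p t)) = 0"
    if "\<And>v. FD \<phi> (?p s) (J (?p 0) v) = \<kappa> * FD \<phi> (?p s) v"
      "\<And>v. FD \<phi> (?p t) (J (?p 0) v) = \<kappa> * FD \<phi> (?p t) v" "\<kappa> \<noteq> 0" for s t \<kappa>
    using pairing_zero[OF oc lin lin that(3,1,2)] .
  show ?thesis
    using sign[of 0] sign[of 1] sign[of 2] z[of 0 \<i> 1] z[of 0 "-\<i>" 1] z[of 0 \<i> 2] z[of 0 "-\<i>" 2]
      z[of 1 \<i> 2] z[of 1 "-\<i>" 2]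
    by auto
qed

section \<open>Hermitian structures given by one complex function\<close>

text \<open>In coordinates \<open>z\<^sub>k\<close> on \<open>\<real>\<^sup>2\<^sup>m\<close>, \<open>\<epsilon> k = -1\<close> meaning that the \<open>k\<close>-th one is conjugated, a complex
  number \<open>\<mu>\<close> determines the orthogonal complex structure whose \<open>(1,0)\<close>-covectors are spanned by
  \<open>dz\<^sub>a - \<mu> d(cnj z\<^sub>b)\<close>, \<open>dz\<^sub>b + \<mu> d(cnj z\<^sub>a)\<close> and the remaining \<open>dz\<^sub>k\<close>.\<close>

locale coordinates =
  fixes \<epsilon> :: "'m::finite \<Rightarrow> real" and a b :: 'm
  assumes sign: "\<And>k. \<epsilon> k * \<epsilon> k = 1" and ab: "a \<noteq> b"
begin

definition coord :: "'m \<Rightarrow> real^('m + 'm) \<Rightarrow> complex" where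
  "coord k x = Complex (x $ Inl k) (\<epsilon> k * x $ Inr k)"

text \<open>Inverse to taking all coordinates; \<open>\<epsilon> k\<close> reappears because it is
  its own reciprocal.\<close>

definition assemble :: "('m \<Rightarrow> complex) \<Rightarrow> real^('m + 'm)" where
  "assemble f = (\<chi> i. case i of Inl k \<Rightarrow> Re (f k) | Inr k \<Rightarrow> \<epsilon> k * Im (f k))"

text \<open>Passes from the coordinates of a vector to its values under the (1,0)-covectors. It is
  only real linear, because of the conjugations.\<close>

definition shear :: "complex \<Rightarrow> ('m \<Rightarrow> complex) \<Rightarrow> 'm \<Rightarrow> complex" where
  "shear m f = f(a := f a - m * cnj (f b), b := f b + m * cnj (f a))"

text \<open>The inverse of \<open>shear\<close>; its denominator never vanishes, so every complex
  parameter is admissible.\<close>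

definition unshear :: "complex \<Rightarrow> ('m \<Rightarrow> complex) \<Rightarrow> 'm \<Rightarrow> complex" where
  "unshear m f = f(a := (f a + m * cnj (f b)) / (1 + m * cnj m),
                   b := (f b - m * cnj (f a)) / (1 + m * cnj m))"

definition covector :: "complex \<Rightarrow> 'm \<Rightarrow> real^('m + 'm) \<Rightarrow> complex" where
  "covector m k v = shear m (\<lambda>k. coord k v) k"

definition cstruct ::
    "(real^('m + 'm) \<Rightarrow> complex) \<Rightarrow> real^('m + 'm) \<Rightarrow> real^('m + 'm) \<Rightarrow> real^('m + 'm)" where
  "cstruct \<mu> x v = assemble (unshear (\<mu> x) (\<lambda>k. \<i> * covector (\<mu> x) k v))"

section \<open>Linear algebra of the sheared coordinates\<close>

lemma coord_assemble [simp]: "coord k (assemble f) = f k"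
  by (simp add: coord_def assemble_def complex_eq_iff sign flip: mult.assoc)

lemma coord_eqI: "(\<And>k. coord k x = coord k y) \<Longrightarrow> x = y"
proof -
  assume eq: "\<And>k. coord k x = coord k y"
  have "x $ Inl k = y $ Inl k" "x $ Inr k = y $ Inr k" for k
    using eq[of k] sign[of k] by (auto simp: coord_def complex_eq_iff)
  then show "x = y" by (metis sum.exhaust vec_eq_iff)
qed

lemma coord_linear [simp]:
  "coord k (x + y) = coord k x + coord k y" "coord k (- x) = - coord k x"
  "coord k (x - y) = coord k x - coord k y" "coord k (t *\<^sub>R x) = of_real t * coord k x"
  "coord k 0 = 0"
  by (simp_all add: coord_def complex_eq_iff algebra_simps)

lemma bounded_linear_coord: "bounded_linear (coord k)"
  unfolding linear_conv_bounded_linear[symmetric]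
  by (auto intro!: linearI simp: scaleR_conv_of_real[where 'a = complex])

lemmas coord_has_derivative =
  bounded_linear.has_derivative[OF bounded_linear_coord has_derivative_ident]

lemma smooth_on_coord: "open U \<Longrightarrow> smooth_on U (coord k)"
  by (rule smooth_on_bounded_linear[OF _ bounded_linear_coord])

lemma assemble_has_derivative:
  assumes "\<And>k. (f k has_derivative f' k) F"
  shows "((\<lambda>x. assemble (\<lambda>k. f k x)) has_derivative (\<lambda>v. assemble (\<lambda>k. f' k v))) F"
  unfolding assemble_def
proof (rule has_derivative_vec)
  fix i :: "'m + 'm"
  show "((\<lambda>x. case i of Inl k \<Rightarrow> Re (f k x) | Inr k \<Rightarrow> \<epsilon> k * Im (f k x)) has_derivative
      (\<lambda>v. case i of Inl k \<Rightarrow> Re (f' k v) | Inr k \<Rightarrow> \<epsilon> k * Im (f' k v))) F"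
    using assms by (cases i)
      (auto intro!: has_derivative_mult_right bounded_linear.has_derivative[OF bounded_linear_Re]
        bounded_linear.has_derivative[OF bounded_linear_Im])
qed

lemma coord_axis [simp]:
  "coord j (axis (Inl k) 1) = (if j = k then 1 else 0)"
  "coord j (axis (Inr k) 1) = (if j = k then of_real (\<epsilon> k) * \<i> else 0)"
  by (auto simp: coord_def axis_def complex_eq_iff)

lemma norm_coord: "(norm x)\<^sup>2 = (\<Sum>k\<in>UNIV. (norm (coord k x))\<^sup>2)"
proof -
  have "(norm x)\<^sup>2 = (\<Sum>i\<in>UNIV. (x $ i)\<^sup>2)"
    unfolding power2_norm_eq_inner by (simp add: inner_vec_def power2_eq_square)
  also have "\<dots> = (\<Sum>k\<in>UNIV. (x $ Inl k)\<^sup>2) + (\<Sum>k\<in>UNIV. (x $ Inr k)\<^sup>2)"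
    by (simp add: UNIV_Plus_UNIV[symmetric] sum.Plus del: UNIV_Plus_UNIV)
  also have "\<dots> = (\<Sum>k\<in>UNIV. (norm (coord k x))\<^sup>2)"
    by (simp add: coord_def cmod_power2 power_mult_distrib power2_eq_square[of "\<epsilon> _"] sign sum.distrib)
  finally show ?thesis .
qed

lemma one_plus_nonzero: "1 + m * cnj m \<noteq> 0"
proof -
  have "Re (1 + m * cnj m) > 0"
    by (simp add: add_pos_nonneg flip: power2_eq_square)
  then show ?thesis by force
qed

lemma shear_unshear [simp]: "shear m (unshear m f) = f"
proof -
  have n: "1 + m * cnj m \<noteq> 0" "1 + cnj m * m \<noteq> 0"
    using one_plus_nonzero[of m] by (simp_all add: mult.commute)
  have "(f a + m * cnj (f b)) / (1 + m * cnj m) - m * cnj ((f b - m * cnj (f a)) / (1 + m * cnj m)) = f a"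
    "(f b - m * cnj (f a)) / (1 + m * cnj m) + m * cnj ((f a + m * cnj (f b)) / (1 + m * cnj m)) = f b"
    using n by (simp_all add: mult.commute[of "cnj m" m] divide_simps) (simp_all add: algebra_simps)
  then show ?thesis using ab by (simp add: shear_def unshear_def fun_eq_iff)
qed

lemma unshear_shear [simp]: "unshear m (shear m f) = f"
proof -
  have "(f a - m * cnj (f b) + m * cnj (f b + m * cnj (f a))) = f a * (1 + m * cnj m)"
    "(f b + m * cnj (f a) - m * cnj (f a - m * cnj (f b))) = f b * (1 + m * cnj m)"
    by (simp_all add: algebra_simps)
  then show ?thesis using ab one_plus_nonzero[of m] by (simp add: shear_def unshear_def fun_eq_iff)
qed

lemma covector_simps:
  "covector m a v = coord a v - m * cnj (coord b v)"
  "covector m b v = coord b v + m * cnj (coord a v)"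
  "k \<noteq> a \<Longrightarrow> k \<noteq> b \<Longrightarrow> covector m k v = coord k v"
  using ab by (simp_all add: covector_def shear_def)

lemma covector_assemble_unshear [simp]: "covector m k (assemble (unshear m f)) = f k"
  by (simp add: covector_def)

lemma assemble_unshear_covector [simp]: "assemble (unshear m (\<lambda>k. covector m k v)) = v"
  by (rule coord_eqI) (simp add: covector_def[abs_def])

lemma covector_eqI: "(\<And>k. covector m k v = covector m k w) \<Longrightarrow> v = w"
  by (metis (no_types, lifting) assemble_unshear_covector ext)

lemma covector_linear:
  "covector m k (v + w) = covector m k v + covector m k w"
  "covector m k (- v) = - covector m k v"
  "covector m k (t *\<^sub>R v) = of_real t * covector m k v"
  by (simp_all add: covector_def shear_def algebra_simps)

lemma covector_cstruct [simp]: "covector (\<mu> x) k (cstruct \<mu> x v) = \<i> * covector (\<mu> x) k v"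
  by (simp add: cstruct_def)

text \<open>The opposite signs in \<open>shear\<close> cancel the cross terms, so on the coordinates
  \<open>a\<close> and \<open>b\<close> the shear is a similarity. This is what makes
  \<open>cstruct\<close> orthogonal.\<close>

lemma norm_covector:
  "(norm (covector m a v))\<^sup>2 + (norm (covector m b v))\<^sup>2
    = (1 + (norm m)\<^sup>2) * ((norm (coord a v))\<^sup>2 + (norm (coord b v))\<^sup>2)"
  unfolding covector_simps cmod_power2 by (simp add: power2_eq_square algebra_simps)

lemma orthogonal_complex_cstruct: "orthogonal_complex (cstruct \<mu> x)"
proof
  let ?J = "cstruct \<mu> x"
  show sq: "?J (?J v) = - v" for v
    by (rule covector_eqI[of "\<mu> x"]) (simp add: covector_linear flip: mult.assoc)
  have "linear ?J"
    by (rule linearI; rule covector_eqI[of "\<mu> x"]) (simp_all add: covector_linear algebra_simps)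
  moreover have "norm (?J v) = norm v" for v
  proof -
    let ?s = "\<lambda>v. (norm (coord a v))\<^sup>2 + (norm (coord b v))\<^sup>2"
    \<comment> \<open>The structure multiplies covector values by \<open>\<i>\<close>, which keeps
      their moduli; the similarity factor then cancels.\<close>
    have "(1 + (norm (\<mu> x))\<^sup>2) * ?s (?J v) = (1 + (norm (\<mu> x))\<^sup>2) * ?s v"
      unfolding norm_covector[symmetric] by (simp add: norm_mult)
    moreover have "1 + (norm (\<mu> x))\<^sup>2 \<noteq> 0"
      by (smt (verit) zero_le_power2)
    ultimately have s: "?s (?J v) = ?s v" by (metis mult_left_cancel)
    have r: "coord k (?J v) = \<i> * coord k v" if "k \<notin> {a, b}" for k
      using covector_cstruct[of \<mu> x k v] that by (simp add: covector_simps del: covector_cstruct)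
    have split: "(norm w)\<^sup>2 = ?s w + (\<Sum>k\<in>-{a,b}. (norm (coord k w))\<^sup>2)" for w
      unfolding norm_coord using ab
      by (simp add: sum.subset_diff[of "{a, b}" UNIV] Compl_eq_Diff_UNIV)
    have "(norm (?J v))\<^sup>2 = (norm v)\<^sup>2"
      unfolding split[of "?J v"] split[of v] using s r by (simp add: norm_mult)
    then show ?thesis by (simp add: power2_eq_iff_nonneg)
  qed
  ultimately show "orthogonal_transformation ?J"
    by (simp add: orthogonal_transformation)
qed

section \<open>Smoothness and integrability of the structures\<close>

lemma smooth_on_assemble:
  assumes "open U" "\<And>k. smooth_on U (f k)"
  shows "smooth_on U (\<lambda>x. assemble (\<lambda>k. f k x))"
  unfolding assemble_def
proof (rule smooth_on_vec[OF assms(1)])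
  fix i :: "'m + 'm"
  show "smooth_on U (\<lambda>x. case i of Inl k \<Rightarrow> Re (f k x) | Inr k \<Rightarrow> \<epsilon> k * Im (f k x))"
    using assms by (cases i)
      (auto intro!: smooth_on_mult smooth_on_const smooth_on_linear_compose[OF _ bounded_linear_Re]
        smooth_on_linear_compose[OF _ bounded_linear_Im])
qed

lemma smooth_on_unshear:
  assumes "open U" "smooth_on U m" "\<And>k. smooth_on U (f k)"
  shows "smooth_on U (\<lambda>x. unshear (m x) (\<lambda>k. f k x) k)"
  using assms one_plus_nonzero ab
  by (cases "k = b"; cases "k = a") (auto simp: unshear_def intro!: smooth_on_divide smooth_on_add smooth_on_diff smooth_on_mult
      smooth_on_cnj smooth_on_const)

lemma smooth_on_covector:
  assumes "open U" "smooth_on U m" "\<And>k. smooth_on U (\<lambda>x. coord k (v x))"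
  shows "smooth_on U (\<lambda>x. covector (m x) k (v x))"
  using assms ab
  by (cases "k = b"; cases "k = a") (auto simp: covector_def shear_def intro!: smooth_on_add smooth_on_diff smooth_on_mult smooth_on_cnj)

lemma almost_hermitian_cstruct:
  assumes "open U" "smooth_on U \<mu>"
  shows "almost_hermitian_structure U (cstruct \<mu>)"
  unfolding almost_hermitian_structure_def
proof (intro conjI ballI allI)
  fix x v
  show "orthogonal_transformation (cstruct \<mu> x)" "cstruct \<mu> x (cstruct \<mu> x v) = - v"
    using orthogonal_complex_cstruct[of \<mu> x] by (simp_all add: orthogonal_complex_def)
  show "smooth_on U (\<lambda>x. cstruct \<mu> x v)"
    unfolding cstruct_def
    by (intro smooth_on_assemble smooth_on_unshear smooth_on_mult smooth_on_covector
        smooth_on_const assms)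
qed

text \<open>Besides the covector at \<open>x\<close>, only a multiple of the differential of
  \<open>\<mu>\<close> appears. If \<open>\<mu>\<close> is holomorphic for its own structure, both
  terms have type (1,0), which is the reason for \<open>holomorphic_covector\<close>.\<close>

lemma covector_has_derivative:
  assumes "(\<mu> has_derivative \<mu>') (at x)"
  shows "((\<lambda>y. covector (\<mu> y) k y) has_derivative (\<lambda>v. covector (\<mu> x) k v +
    \<mu>' v * (if k = b then cnj (coord a x) else if k = a then - cnj (coord b x) else 0))) (at x)"
proof -
  note d = assms coord_has_derivative bounded_linear.has_derivative[OF bounded_linear_cnj coord_has_derivative]
  consider "k = a" | "k = b" | "k \<noteq> a" "k \<noteq> b" by blast
  then show ?thesis
  proof cases
    case 1
    then show ?thesis using ab by (simp add: covector_simps)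
        (rule derivative_eq_intros d refl | simp add: algebra_simps fun_eq_iff)+
  next
    case 2
    then show ?thesis by (simp add: covector_simps)
        (rule derivative_eq_intros d refl | simp add: algebra_simps fun_eq_iff)+
  next
    case 3
    then show ?thesis by (simp add: covector_simps d)
  qed
qed

lemma holomorphic_covector:
  assumes "holomorphic_wrt U (cstruct \<mu>) \<mu>"
  shows "holomorphic_wrt U (cstruct \<mu>) (\<lambda>y. covector (\<mu> y) k y)"
proof (rule holomorphic_wrtI)
  fix x v assume x: "x \<in> U"
  then have "(\<mu> has_derivative FD \<mu> x) (at x)"
    using assms by (simp add: holomorphic_wrt_def frechet_derivative_works)
  from covector_has_derivative[OF this]
  show "((\<lambda>y. covector (\<mu> y) k y) has_derivative (\<lambda>v. covector (\<mu> x) k v + FD \<mu> x v *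
    (if k = b then cnj (coord a x) else if k = a then - cnj (coord b x) else 0))) (at x)" .
  show "covector (\<mu> x) k (cstruct \<mu> x v) + FD \<mu> x (cstruct \<mu> x v) *
      (if k = b then cnj (coord a x) else if k = a then - cnj (coord b x) else 0)
    = \<i> * (covector (\<mu> x) k v + FD \<mu> x v *
      (if k = b then cnj (coord a x) else if k = a then - cnj (coord b x) else 0))"
    using holomorphic_wrt_at(2)[OF assms x] by (simp add: algebra_simps)
qed

text \<open>The covectors at \<open>x\<close>, evaluated at the position vector \<open>x\<close>, are holomorphic coordinates \<open>w\<close>.
  They invert explicitly once \<open>\<mu>\<close> is known as a function \<open>h\<close> of \<open>w\<close>.\<close>

lemma hermitian_cstruct:
  assumes U: "open U" and \<mu>: "smooth_on U \<mu>" "holomorphic_wrt U (cstruct \<mu>) \<mu>"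
    and h: "smooth_on UNIV h"
    and hw: "\<And>x. x \<in> U \<Longrightarrow> h (\<chi> k. covector (\<mu> x) k x) = \<mu> x"
    and \<mu>w: "\<And>w. assemble (unshear (h w) (\<lambda>k. w $ k)) \<in> U
      \<Longrightarrow> \<mu> (assemble (unshear (h w) (\<lambda>k. w $ k))) = h w"
  shows "hermitian_structure U (cstruct \<mu>)"
proof -
  let ?\<psi> = "\<lambda>x. \<chi> k. covector (\<mu> x) k x" and ?\<eta> = "\<lambda>w. assemble (unshear (h w) (\<lambda>k. w $ k))"
  have chart: "chart_on U ?\<psi>"
  proof (rule chart_on_explicit[where \<eta> = ?\<eta>])
    show "smooth_on U ?\<psi>"
      using U \<mu> smooth_on_coord by (intro smooth_on_vec smooth_on_covector) auto
    show "smooth_on UNIV ?\<eta>"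
      by (intro smooth_on_assemble smooth_on_unshear h smooth_on_bounded_linear
          bounded_linear_vec_nth open_UNIV)
    show "?\<eta> (?\<psi> x) = x" if "x \<in> U" for x using hw[OF that] by simp
    show "?\<psi> (?\<eta> w) = w" if "?\<eta> w \<in> U" for w using \<mu>w[OF that] by (simp add: vec_eq_iff)
  qed fact
  have "FD ?\<psi> y (cstruct \<mu> y v) = \<i> *s FD ?\<psi> y v" if "y \<in> U" for y v
  proof -
    note w = holomorphic_covector[OF \<mu>(2), unfolded holomorphic_wrt_def, rule_format, OF that]
    have "(?\<psi> has_derivative (\<lambda>v. \<chi> k. FD (\<lambda>y. covector (\<mu> y) k y) y v)) (at y)"
      using w by (intro has_derivative_vec) (simp add: frechet_derivative_works)
    from frechet_derivative_at[OF this] show ?thesis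
      using w by (simp add: vec_eq_iff fun_eq_iff)
  qed
  then have "integrable_structure U (cstruct \<mu>)"
    unfolding integrable_structure_def using chart by blast
  then show ?thesis
    using almost_hermitian_cstruct[OF U \<mu>(1)] by (simp add: hermitian_structure_def)
qed

end

section \<open>The examples\<close>

lemma sum_UNIV_Plus:
  "(\<Sum>i\<in>UNIV. f i) = (\<Sum>k\<in>UNIV. f (Inl k)) + (\<Sum>k\<in>UNIV. f (Inr k))"
  for f :: "'m::finite + 'm \<Rightarrow> 'b::comm_monoid_add"
  by (simp add: UNIV_Plus_UNIV[symmetric] sum.Plus del: UNIV_Plus_UNIV)

locale three_indices =
  fixes a b c :: "'m::finite"
  assumes distinct: "a \<noteq> b" "a \<noteq> c" "b \<noteq> c"
begin

sublocale p: coordinates "\<lambda>_. 1" a b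
  by standard (simp_all add: distinct)

text \<open>Conjugating one coordinate reverses the orientation; \<open>J1\<close> is built in this
  system.\<close>

sublocale q: coordinates "(\<lambda>_. 1)(b := -1)" a b
  by standard (simp_all add: distinct)

lemma q_coord: "q.coord k x = (if k = b then cnj (p.coord k x) else p.coord k x)"
  by (simp add: p.coord_def q.coord_def complex_eq_iff)

section \<open>The functions, the structures and their differentials\<close>

abbreviation z :: "'m \<Rightarrow> real^('m + 'm) \<Rightarrow> complex" where "z \<equiv> p.coord"

definition W1 :: "real^('m + 'm) \<Rightarrow> complex" where
  "W1 x = z a x + z c x * cnj (z b x)"

definition W2 :: "real^('m + 'm) \<Rightarrow> complex" where
  "W2 x = z b x - z c x * cnj (z a x)"

definition g :: "real^('m + 'm) \<Rightarrow> complex" where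
  "g x = (\<Sum>k\<in>-{a,b,c}. z k x * z k x)"

definition den :: "real^('m + 'm) \<Rightarrow> complex" where
  "den x = 1 + W2 x"

definition \<phi>1 :: "real^('m + 'm) \<Rightarrow> complex" where
  "\<phi>1 x = (W1 x + g x) / den x"

definition U1 :: "(real^('m + 'm)) set" where
  "U1 = {x. den x \<noteq> 0}"

definition \<phi>2 :: "real^('m + 'm) \<Rightarrow> complex" where
  "\<phi>2 x = W1 x + z c x * z c x * W2 x + g x"

abbreviation J0 :: "real^('m + 'm) \<Rightarrow> real^('m + 'm) \<Rightarrow> real^('m + 'm)" where
  "J0 \<equiv> p.cstruct (\<lambda>x. - z c x)"

abbreviation J1 :: "real^('m + 'm) \<Rightarrow> real^('m + 'm) \<Rightarrow> real^('m + 'm)" where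
  "J1 \<equiv> q.cstruct \<phi>1"

definition dW1 :: "real^('m + 'm) \<Rightarrow> real^('m + 'm) \<Rightarrow> complex" where
  "dW1 x v = z a v + z c x * cnj (z b v) + z c v * cnj (z b x)"

definition dW2 :: "real^('m + 'm) \<Rightarrow> real^('m + 'm) \<Rightarrow> complex" where
  "dW2 x v = z b v - z c x * cnj (z a v) - z c v * cnj (z a x)"

definition dg :: "real^('m + 'm) \<Rightarrow> real^('m + 'm) \<Rightarrow> complex" where
  "dg x v = (\<Sum>k\<in>-{a,b,c}. 2 * z k x * z k v)"

lemma z_deriv: "(z k has_derivative z k) F" "((\<lambda>x. cnj (z k x)) has_derivative (\<lambda>v. cnj (z k v))) F"
  using p.coord_has_derivative bounded_linear.has_derivative[OF bounded_linear_cnj p.coord_has_derivative]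
  by auto

lemma W1_deriv: "(W1 has_derivative dW1 x) (at x)"
  unfolding W1_def[abs_def] dW1_def[abs_def]
  by (rule derivative_eq_intros z_deriv refl | simp add: algebra_simps)+

lemma W2_deriv: "(W2 has_derivative dW2 x) (at x)"
  unfolding W2_def[abs_def] dW2_def[abs_def]
  by (rule derivative_eq_intros z_deriv refl | simp add: algebra_simps)+

lemma g_deriv: "(g has_derivative dg x) (at x)"
  unfolding g_def[abs_def] dg_def[abs_def]
  by (rule derivative_eq_intros z_deriv refl | simp add: algebra_simps)+

lemma z_smooth: "open U \<Longrightarrow> smooth_on U (z k)"
  by (rule p.smooth_on_coord)

section \<open>Holomorphic harmonic functions of the structure \<open>J0\<close>\<close>

lemma holomorphic_z:
  "k \<noteq> a \<Longrightarrow> k \<noteq> b \<Longrightarrow> holomorphic_wrt U (p.cstruct \<mu>) (z k)"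
  using p.covector_cstruct[of \<mu> _ k]
  by (intro holomorphic_wrtI[where f' = "\<lambda>x. z k", OF z_deriv(1)])
    (simp add: p.covector_simps del: p.covector_cstruct)

lemma holomorphic_minus_z: "holomorphic_wrt U J0 (\<lambda>x. - z c x)"
proof (rule holomorphic_wrtI[where f' = "\<lambda>x v. - z c v"])
  show "((\<lambda>x. - z c x) has_derivative (\<lambda>v. - z c v)) (at x)" for x
    by (intro has_derivative_minus z_deriv)
  show "- z c (J0 x v) = \<i> * - z c v" for x v
    using p.covector_cstruct[of "\<lambda>x. - z c x" x c v] distinct
    by (simp add: p.covector_simps del: p.covector_cstruct)
qed

lemma almost_hermitian_J0: "open U \<Longrightarrow> almost_hermitian_structure U J0"
  by (intro p.almost_hermitian_cstruct smooth_on_minus z_smooth)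

lemma hermitian_J0:
  assumes "open U" shows "hermitian_structure U J0"
proof (rule p.hermitian_cstruct[where h = "\<lambda>w. - w $ c"])
  show "smooth_on U (\<lambda>x. - z c x)" by (intro smooth_on_minus z_smooth assms)
  show "smooth_on UNIV (\<lambda>w. - w $ c)"
    by (intro smooth_on_minus smooth_on_bounded_linear bounded_linear_vec_nth open_UNIV)
qed (use assms distinct holomorphic_minus_z in \<open>auto simp: p.covector_simps p.unshear_def\<close>)

lemma pairing_split:
  fixes A B :: "real^('m + 'm) \<Rightarrow> complex"
  shows "pairing A B = (\<Sum>k\<in>UNIV. A (axis (Inl k) 1) * B (axis (Inl k) 1)
    + A (axis (Inr k) 1) * B (axis (Inr k) 1))"
  by (simp add: pairing_def sum_UNIV_Plus sum.distrib)

text \<open>Both factors are harmonic, and their differentials involve different coordinate planes,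
  so the cross term vanishes.\<close>

lemma laplacian_mixed:
  assumes "j \<noteq> k" shows "laplacian (\<lambda>x. z j x * cnj (z k x)) x = 0"
proof -
  have 1: "laplacian (z j) x = 0" "laplacian (\<lambda>x. cnj (z k x)) x = 0"
    by (intro laplacian_bounded_linear p.bounded_linear_coord
        bounded_linear_compose[OF bounded_linear_cnj])+
  have 2: "FD (z j) x = z j" "FD (\<lambda>x. cnj (z k x)) x = (\<lambda>v. cnj (z k v))"
    using frechet_derivative_at[OF z_deriv(1)] frechet_derivative_at[OF z_deriv(2)] by metis+
  have "pairing (z j) (\<lambda>v. cnj (z k v)) = 0"
    unfolding pairing_split using assms by (intro sum.neutral) auto
  then show ?thesis
    using laplacian_mult[of UNIV "z j" "\<lambda>x. cnj (z k x)" x] 1 2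
    by (simp add: z_smooth smooth_on_cnj)
qed

lemma holomorphic_harmonic_z: "open U \<Longrightarrow> k \<noteq> a \<Longrightarrow> k \<noteq> b \<Longrightarrow> holomorphic_harmonic U J0 (z k)"
  by (simp add: holomorphic_harmonic_def holomorphic_z z_smooth
      laplacian_bounded_linear[OF p.bounded_linear_coord])

lemma smooth_W: "open U \<Longrightarrow> smooth_on U W1" "open U \<Longrightarrow> smooth_on U W2"
  unfolding W1_def[abs_def] W2_def[abs_def]
  by (intro smooth_on_add smooth_on_diff smooth_on_mult smooth_on_cnj z_smooth; assumption)+

text \<open>\<open>W1\<close> and \<open>W2\<close> are covectors of \<open>J0\<close> at
  \<open>x\<close> evaluated at \<open>x\<close>, hence holomorphic. They are harmonic because every
  quadratic term mixes two distinct coordinates.\<close>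

lemma holomorphic_harmonic_W:
  assumes "open U"
  shows "holomorphic_harmonic U J0 W1" "holomorphic_harmonic U J0 W2"
proof -
  have W: "W1 = (\<lambda>x. p.covector (- z c x) a x)" "W2 = (\<lambda>x. p.covector (- z c x) b x)"
    by (simp_all add: fun_eq_iff W1_def W2_def p.covector_simps)
  have "laplacian (\<lambda>x. z a x + z c x * cnj (z b x)) x = 0" for x
    using laplacian_add[of UNIV "z a" "\<lambda>x. z c x * cnj (z b x)" x] distinct
    by (simp add: laplacian_mixed laplacian_bounded_linear[OF p.bounded_linear_coord] z_smooth
        smooth_on_mult smooth_on_cnj)
  then have 1: "laplacian W1 x = 0" for x by (simp add: W1_def[abs_def])
  \<comment> \<open>The difference is written with a constant factor \<open>-1\<close> so that the
    sum and product rules apply.\<close>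
  have "laplacian (\<lambda>x. z b x + (-1) * (z c x * cnj (z a x))) x = 0" for x
    using laplacian_add[of UNIV "z b" "\<lambda>x. (-1) * (z c x * cnj (z a x))" x] distinct
      laplacian_mult[of UNIV "\<lambda>x. -1" "\<lambda>x. z c x * cnj (z a x)" x]
    by (simp add: laplacian_mixed laplacian_bounded_linear[OF p.bounded_linear_coord] z_smooth
        smooth_on_mult smooth_on_cnj smooth_on_const laplacian_const smooth_on_minus pairing_def
        frechet_derivative_const)
  then have 2: "laplacian W2 x = 0" for x by (simp add: W2_def[abs_def])
  show "holomorphic_harmonic U J0 W1" "holomorphic_harmonic U J0 W2"
    using 1 2 smooth_W[OF assms] p.holomorphic_covector[OF holomorphic_minus_z]
    by (simp_all add: holomorphic_harmonic_def W[symmetric]) (simp_all add: W)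
qed

lemma holomorphic_harmonic_g:
  assumes "open U" shows "holomorphic_harmonic U J0 g"
  unfolding g_def[abs_def]
  by (intro holomorphic_harmonic_sum holomorphic_harmonic_mult holomorphic_harmonic_z
      almost_hermitian_J0 assms) auto

lemma open_U1: "open U1"
proof -
  have "continuous_on UNIV den"
    unfolding den_def[abs_def]
    by (intro continuous_intros) (use W2_deriv has_derivative_continuous_on in blast)
  then have "open (den -` (-{0}))" by (intro open_vimage) auto
  also have "den -` (-{0}) = U1" by (auto simp: U1_def)
  finally show ?thesis .
qed

lemma holomorphic_harmonic_\<phi>1: "holomorphic_harmonic U1 J0 \<phi>1"
  unfolding \<phi>1_def[abs_def] divide_inverse den_def
  by (intro holomorphic_harmonic_mult holomorphic_harmonic_add holomorphic_harmonic_inverse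
      holomorphic_harmonic_const holomorphic_harmonic_W holomorphic_harmonic_g almost_hermitian_J0
      open_U1) (simp add: U1_def den_def)

lemma holomorphic_harmonic_\<phi>2: "holomorphic_harmonic UNIV J0 \<phi>2"
  unfolding \<phi>2_def[abs_def]
  by (intro holomorphic_harmonic_mult holomorphic_harmonic_add holomorphic_harmonic_z
      holomorphic_harmonic_W holomorphic_harmonic_g almost_hermitian_J0 open_UNIV)
    (use distinct in auto)

section \<open>Differentials of the two examples and fullness\<close>

lemma FD_\<phi>1:
  assumes "x \<in> U1"
  shows "FD \<phi>1 x v = (dW1 x v + dg x v - \<phi>1 x * dW2 x v) / den x"
proof -
  have n: "den x \<noteq> 0" using assms by (simp add: U1_def)
  have d: "(den has_derivative dW2 x) (at x)"
    unfolding den_def[abs_def] using has_derivative_add[OF has_derivative_const W2_deriv] by simp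
  have "(\<phi>1 has_derivative (\<lambda>v. (dW1 x v + dg x v - \<phi>1 x * dW2 x v) / den x)) (at x)"
    unfolding \<phi>1_def[abs_def]
    by (rule derivative_eq_intros W1_deriv g_deriv d refl n)+
      (use n in \<open>simp add: fun_eq_iff divide_simps \<phi>1_def algebra_simps\<close>)
  from frechet_derivative_at[OF this, symmetric] show ?thesis by simp
qed

lemma FD_\<phi>2:
  "FD \<phi>2 x v = dW1 x v + z c x * z c x * dW2 x v + 2 * z c x * z c v * W2 x + dg x v"
proof -
  have "(\<phi>2 has_derivative
      (\<lambda>v. dW1 x v + z c x * z c x * dW2 x v + 2 * z c x * z c v * W2 x + dg x v)) (at x)"
    unfolding \<phi>2_def[abs_def]
    by (rule derivative_eq_intros W1_deriv W2_deriv g_deriv z_deriv refl)+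
      (simp add: fun_eq_iff algebra_simps)
  from frechet_derivative_at[OF this, symmetric] show ?thesis by simp
qed

lemmas dsimps = dW1_def dW2_def W1_def W2_def den_def

definition pt :: "'m \<Rightarrow> complex \<Rightarrow> real^('m + 'm)" where
  "pt k s = p.assemble ((\<lambda>_. 0)(k := s))"

lemma z_pt [simp]: "z j (pt k s) = (if j = k then s else 0)"
  by (simp add: pt_def)

lemma g_pt: "g (pt k s) = (if k \<in> {a,b,c} then 0 else s * s)"
  by (simp add: g_def if_distrib cong: if_cong)

lemma dg_pt: "dg (pt k s) v = (if k \<in> {a,b,c} then 0 else 2 * s * z k v)"
proof -
  have "2 * z j (pt k s) * z j v = (if j = k then 2 * s * z k v else 0)" for j
    by simp
  then show ?thesis by (simp add: dg_def del: z_pt)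
qed

lemma all_z_zero: "z a v = 0 \<Longrightarrow> z b v = 0 \<Longrightarrow> z c v = 0 \<Longrightarrow>
  (\<And>k. k \<notin> {a,b,c} \<Longrightarrow> z k v = 0) \<Longrightarrow> v = 0"
  by (rule p.coord_eqI) (metis insert_iff p.coord_linear(5) singletonD)

text \<open>The coordinates of a vector killed by all differentials are eliminated one at a time at
  test points on the coordinate axes.\<close>

lemma full_\<phi>1: "full_on U1 \<phi>1"
proof (rule full_onI[OF open_U1])
  show "\<phi>1 differentiable at x" if "x \<in> U1" for x
    using holomorphic_harmonic_\<phi>1 that by (auto simp: holomorphic_harmonic_def dest: smooth_on_D)
  fix v assume v: "\<And>x. x \<in> U1 \<Longrightarrow> FD \<phi>1 x v = 0"
  \<comment> \<open>At zeros of \<open>\<phi>1\<close> the contribution of the denominator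
    disappears; the first three test points are such zeros.\<close>
  have "\<phi>1 x = 0 \<Longrightarrow> x \<in> U1 \<Longrightarrow> dW1 x v + dg x v = 0" for x
    using v[of x] by (simp add: FD_\<phi>1 U1_def)
  note e = this[unfolded \<phi>1_def U1_def, simplified]
  have va: "z a v = 0" using e[of "pt a 0"] distinct by (simp add: dsimps g_pt dg_pt)
  have vb: "z b v = 0" using e[of "pt c 1"] va distinct by (simp add: dsimps g_pt dg_pt)
  have vc: "z c v = 0" using e[of "pt b 1"] va vb distinct by (simp add: dsimps g_pt dg_pt)
  have "z k v = 0" if "k \<notin> {a,b,c}" for k
  proof -
    have "pt k 1 \<in> U1" using that by (auto simp: U1_def dsimps)
    from v[OF this] show ?thesis
      using that va vb vc by (auto simp: FD_\<phi>1[OF \<open>pt k 1 \<in> U1\<close>] dsimps g_pt dg_pt)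
  qed
  with va vb vc show "v = 0" by (rule all_z_zero)
qed

lemma full_\<phi>2: "full_on UNIV \<phi>2"
proof (rule full_onI)
  show "\<phi>2 differentiable at x" for x
    using holomorphic_harmonic_\<phi>2 by (auto simp: holomorphic_harmonic_def dest: smooth_on_D)
  fix v assume "\<And>x. x \<in> UNIV \<Longrightarrow> FD \<phi>2 x v = 0"
  then have e: "dW1 x v + z c x * z c x * dW2 x v + 2 * z c x * z c v * W2 x + dg x v = 0" for x
    by (simp add: FD_\<phi>2)
  have va: "z a v = 0" using e[of "pt a 0"] distinct by (simp add: dsimps dg_pt)
  have "cnj (z b v) + z b v = 0" using e[of "pt c 1"] va distinct by (simp add: dsimps dg_pt)
  \<comment> \<open>The points \<open>1\<close> and \<open>-1\<close> on the axis give both signs of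
    the conjugate term, which separates \<open>z b v\<close> from its conjugate.\<close>
  moreover have "z b v - cnj (z b v) = 0" using e[of "pt c (-1)"] va distinct by (simp add: dsimps dg_pt)
  ultimately have vb: "z b v = 0" by (simp add: complex_eq_iff)
  have vc: "z c v = 0" using e[of "pt b 1"] va vb distinct by (simp add: dsimps dg_pt)
  have "z k v = 0" if "k \<notin> {a,b,c}" for k
    using e[of "pt k 1"] va vb vc that by (auto simp: dsimps dg_pt)
  with va vb vc show "v = 0" by (rule all_z_zero)
qed simp

lemma smooth_\<phi>: "smooth_on U1 \<phi>1" "smooth_on UNIV \<phi>2"
  and holomorphic_\<phi>: "holomorphic_wrt U1 J0 \<phi>1" "holomorphic_wrt UNIV J0 \<phi>2"
  using holomorphic_harmonic_\<phi>1 holomorphic_harmonic_\<phi>2 by (simp_all add: holomorphic_harmonic_def)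

text \<open>Moving \<open>x\<close> by the following vector changes \<open>W1\<close> by \<open>r\<close> and neither \<open>W2\<close> nor the \<open>z k\<close> with
  \<open>k \<noteq> a, b\<close>.\<close>

definition lift :: "complex \<Rightarrow> complex \<Rightarrow> real^('m + 'm)" where
  "lift s r = p.assemble ((\<lambda>_. 0)(a := r / (1 + s * cnj s), b := s * cnj r / (1 + s * cnj s)))"

lemma z_lift: "z a (lift s r) = r / (1 + s * cnj s)"
  "z b (lift s r) = s * cnj r / (1 + s * cnj s)"
  "k \<noteq> a \<Longrightarrow> k \<noteq> b \<Longrightarrow> z k (lift s r) = 0"
  using distinct by (simp_all add: lift_def)

lemma lift_W1_W2:
  "z a (lift s r) + s * cnj (z b (lift s r)) = r"
  "z b (lift s r) - s * cnj (z a (lift s r)) = 0"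
proof -
  have n: "1 + s * cnj s \<noteq> 0" by (rule p.one_plus_nonzero)
  have "z a (lift s r) + s * cnj (z b (lift s r)) = (r * (1 + s * cnj s)) / (1 + s * cnj s)"
    unfolding z_lift by (simp add: mult.commute[of "cnj s" s] add_divide_distrib algebra_simps)
  then show "z a (lift s r) + s * cnj (z b (lift s r)) = r" using n by simp
  show "z b (lift s r) - s * cnj (z a (lift s r)) = 0"
    unfolding z_lift by (simp add: mult.commute[of "cnj s" s])
qed

lemma shift_lift:
  fixes x r
  defines "y \<equiv> x - lift (z c x) r"
  shows "W1 y = W1 x - r" "W2 y = W2 x" "g y = g x" "z c y = z c x"
proof -
  have r: "z k y = z k x" if "k \<noteq> a" "k \<noteq> b" for k
    using that by (simp add: y_def z_lift)
  show "z c y = z c x" using r distinct by auto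
  show "g y = g x" unfolding g_def by (rule sum.cong) (auto simp: r)
  have "W1 y = W1 x - (z a (lift (z c x) r) + z c x * cnj (z b (lift (z c x) r)))"
    "W2 y = W2 x - (z b (lift (z c x) r) - z c x * cnj (z a (lift (z c x) r)))"
    unfolding W1_def W2_def \<open>z c y = z c x\<close> unfolding y_def by (simp_all add: algebra_simps)
  then show "W1 y = W1 x - r" "W2 y = W2 x"
    unfolding lift_W1_W2 by simp_all
qed

text \<open>As \<open>F x = 0\<close>, differentiating the coefficients of the lift contributes
  nothing at \<open>x\<close>, and \<open>F' v = 0\<close> removes the remaining term. The
  derivative thus fixes \<open>v\<close>, as \<open>tangent_vectors_retraction\<close>
  requires.\<close>

lemma shift_has_derivative:
  assumes F: "(F has_derivative F') (at x)" and "F x = 0" "F' v = 0"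
  obtains R' where "((\<lambda>y. y - lift (z c y) (F y)) has_derivative R') (at x)" "R' v = v"
proof -
  define s where "s = (\<lambda>y. inverse (1 + z c y * cnj (z c y)))"
  have "smooth_on UNIV s" "smooth_on UNIV (\<lambda>y. z c y * s y)"
    unfolding s_def using p.one_plus_nonzero
    by (intro smooth_on_mult smooth_on_inverse smooth_on_add smooth_on_cnj smooth_on_const z_smooth
        open_UNIV; blast)+
  then have s: "(s has_derivative FD s x) (at x)"
      "((\<lambda>y. z c y * s y) has_derivative FD (\<lambda>y. z c y * s y) x) (at x)"
    using smooth_on_D(2) by blast+
  have Fc: "((\<lambda>y. cnj (F y)) has_derivative (\<lambda>w. cnj (F' w))) (at x)"
    using F by (rule bounded_linear.has_derivative[OF bounded_linear_cnj])
  have "((\<lambda>y. p.assemble (\<lambda>k. if k = a then F y * s y else if k = b then cnj (F y) * (z c y * s y) else 0))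
    has_derivative (\<lambda>w. p.assemble (\<lambda>k. if k = a then F x * FD s x w + F' w * s x
      else if k = b then cnj (F x) * FD (\<lambda>y. z c y * s y) x w + cnj (F' w) * (z c x * s x) else 0))) (at x)"
  proof (rule p.assemble_has_derivative)
    fix k
    consider "k = a" | "k = b" | "k \<noteq> a" "k \<noteq> b" by blast
    then show "((\<lambda>y. if k = a then F y * s y else if k = b then cnj (F y) * (z c y * s y) else 0)
      has_derivative (\<lambda>w. if k = a then F x * FD s x w + F' w * s x
      else if k = b then cnj (F x) * FD (\<lambda>y. z c y * s y) x w + cnj (F' w) * (z c x * s x) else 0)) (at x)"
      by cases (use has_derivative_mult[OF F s(1)] has_derivative_mult[OF Fc s(2)] distinct in simp_all)
  qed
  moreover have "lift (z c y) (F y) =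
      p.assemble (\<lambda>k. if k = a then F y * s y else if k = b then cnj (F y) * (z c y * s y) else 0)" for y
    unfolding lift_def s_def divide_inverse using distinct
    by (intro arg_cong[where f = p.assemble]) (auto simp: fun_eq_iff)
  ultimately have "((\<lambda>y. y - lift (z c y) (F y)) has_derivative (\<lambda>w. w - p.assemble (\<lambda>k. if k = a
      then F x * FD s x w + F' w * s x
      else if k = b then cnj (F x) * FD (\<lambda>y. z c y * s y) x w + cnj (F' w) * (z c x * s x) else 0))) (at x)"
    by (simp add: has_derivative_diff[OF has_derivative_ident])
  moreover have "p.assemble (\<lambda>k. if k = a then F x * FD s x v + F' v * s x
      else if k = b then cnj (F x) * FD (\<lambda>y. z c y * s y) x v + cnj (F' v) * (z c x * s x) else 0) = 0"
    using assms(2,3) by (intro p.coord_eqI) simp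
  ultimately show ?thesis using that by simp
qed

section \<open>Submersivity and tangent spaces of the fibres\<close>

lemma submersive_\<phi>1: "submersive_on U1 \<phi>1"
  unfolding submersive_on_def
proof (intro ballI conjI)
  fix x assume x: "x \<in> U1"
  show "\<phi>1 differentiable at x" using smooth_\<phi>(1) x by (rule smooth_on_D)
  \<comment> \<open>Along this vector \<open>W1\<close> grows at unit rate while \<open>W2\<close>
    and \<open>g\<close> are stationary.\<close>
  let ?u = "lift (z c x) 1"
  have "dW1 x ?u = 1" "dW2 x ?u = 0"
    using lift_W1_W2[of "z c x" 1] distinct by (simp_all add: dW1_def dW2_def z_lift(3))
  moreover have "dg x ?u = 0" by (auto simp: dg_def z_lift(3) intro!: sum.neutral)
  ultimately have "FD \<phi>1 x ?u \<noteq> 0" using x by (simp add: FD_\<phi>1 U1_def)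
  then show "surj (FD \<phi>1 x)"
    using surj_if_complex_linear holomorphic_wrt_at[OF holomorphic_\<phi>(1) x] by blast
qed

lemma submersive_\<phi>2: "submersive_on UNIV \<phi>2"
  unfolding submersive_on_def
proof (intro ballI conjI)
  fix x
  show "\<phi>2 differentiable at x" using smooth_\<phi>(2) by (rule smooth_on_D) simp
  let ?u = "lift (z c x) 1"
  have "dW1 x ?u = 1" "dW2 x ?u = 0" "z c ?u = 0"
    using lift_W1_W2[of "z c x" 1] distinct by (simp_all add: dW1_def dW2_def z_lift(3))
  moreover have "dg x ?u = 0" by (auto simp: dg_def z_lift(3) intro!: sum.neutral)
  ultimately have "FD \<phi>2 x ?u \<noteq> 0" by (simp add: FD_\<phi>2)
  then show "surj (FD \<phi>2 x)"
    using surj_if_complex_linear holomorphic_wrt_at[OF holomorphic_\<phi>(2) UNIV_I] by blast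
qed

lemma kernel_tangent_\<phi>1:
  assumes x: "x \<in> U1" and v: "FD \<phi>1 x v = 0"
  shows "v \<in> tangent_vectors {y\<in>U1. \<phi>1 y = \<phi>1 x} x"
proof -
  \<comment> \<open>The defect in the equation of the fibre after clearing the denominator.
    Subtracting its lift corrects \<open>W1\<close> and leaves \<open>g\<close> and
    \<open>den\<close> alone, so points of \<open>U1\<close> move into the fibre within
    \<open>U1\<close>.\<close>
  let ?F = "\<lambda>y. W1 y + g y - \<phi>1 x * den y"
  have F: "(?F has_derivative (\<lambda>w. dW1 x w + dg x w - \<phi>1 x * dW2 x w)) (at x)"
    unfolding den_def by (rule derivative_eq_intros W1_deriv W2_deriv g_deriv refl | simp)+
  have "?F x = 0" using x by (simp add: \<phi>1_def U1_def)
  moreover have "dW1 x v + dg x v - \<phi>1 x * dW2 x v = 0"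
    using v x by (simp add: FD_\<phi>1 U1_def)
  ultimately obtain R' where R: "((\<lambda>y. y - lift (z c y) (?F y)) has_derivative R') (at x)" "R' v = v"
    using shift_has_derivative[OF F] by blast
  show ?thesis
  proof (rule tangent_vectors_retraction[OF open_U1 x _ _ R])
    show "x - lift (z c x) (?F x) = x"
      unfolding \<open>?F x = 0\<close> by (rule p.coord_eqI) (simp add: lift_def)
    fix y assume "y \<in> U1"
    then show "y - lift (z c y) (?F y) \<in> {y\<in>U1. \<phi>1 y = \<phi>1 x}"
      unfolding U1_def \<phi>1_def den_def by (simp add: shift_lift)
  qed
qed

text \<open>\<open>W1\<close> enters \<open>\<phi>2\<close> additively with coefficient 1, so
  shifting by the lift of the defect lands exactly on the fibre.\<close>

lemma kernel_tangent_\<phi>2: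
  assumes v: "FD \<phi>2 x v = 0"
  shows "v \<in> tangent_vectors {y\<in>UNIV. \<phi>2 y = \<phi>2 x} x"
proof -
  let ?F = "\<lambda>y. \<phi>2 y - \<phi>2 x"
  have F: "(?F has_derivative FD \<phi>2 x) (at x)"
    using smooth_on_D(2)[OF smooth_\<phi>(2)] by (auto intro!: derivative_eq_intros)
  have shift: "\<phi>2 (y - lift (z c y) r) = \<phi>2 y - r" for y r
    unfolding \<phi>2_def shift_lift by simp
  obtain R' where R: "((\<lambda>y. y - lift (z c y) (?F y)) has_derivative R') (at x)" "R' v = v"
    using shift_has_derivative[OF F _ v] by auto
  show ?thesis
  proof (rule tangent_vectors_retraction[OF open_UNIV UNIV_I _ _ R])
    show "x - lift (z c x) (?F x) = x"
      by (rule p.coord_eqI) (simp add: lift_def)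
    show "y - lift (z c y) (?F y) \<in> {y\<in>UNIV. \<phi>2 y = \<phi>2 x}" for y
      using shift[of y "?F y"] by simp
  qed
qed

section \<open>Obstructions for the second example\<close>

lemma FD_axis:
  "FD \<phi>2 (t *\<^sub>R pt c 1) v =
    z a v + of_real t * cnj (z b v) + of_real (t\<^sup>2) * (z b v - of_real t * cnj (z a v))"
proof -
  have e: "t *\<^sub>R pt c 1 = pt c (of_real t)"
    by (rule p.coord_eqI) simp
  show ?thesis unfolding e using distinct
    by (simp add: FD_\<phi>2 dsimps dg_pt power2_eq_square)
qed

text \<open>Only \<open>dz\<^sub>k\<close> against its own conjugate pairs nontrivially, with value
  2. The coefficients in \<open>FD_axis\<close> therefore give
  \<open>2 * (s * t\<^sup>2 + s\<^sup>2 * t - s\<^sup>3 - t\<^sup>3)\<close>, which factors as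
  stated.\<close>

lemma pairing_axis:
  "pairing (FD \<phi>2 (s *\<^sub>R pt c 1)) (FD \<phi>2 (t *\<^sub>R pt c 1)) = of_real (-2 * (s + t) * (s - t)\<^sup>2)"
proof -
  have "pairing (FD \<phi>2 (s *\<^sub>R pt c 1)) (FD \<phi>2 (t *\<^sub>R pt c 1)) =
    (\<Sum>k\<in>{a,b}. FD \<phi>2 (s *\<^sub>R pt c 1) (axis (Inl k) 1) * FD \<phi>2 (t *\<^sub>R pt c 1) (axis (Inl k) 1)
    + FD \<phi>2 (s *\<^sub>R pt c 1) (axis (Inr k) 1) * FD \<phi>2 (t *\<^sub>R pt c 1) (axis (Inr k) 1))"
    unfolding pairing_split by (rule sum.mono_neutral_right) (auto simp: FD_axis)
  also have "\<dots> = of_real (-2 * (s + t) * (s - t)\<^sup>2)"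
    using distinct by (simp add: FD_axis power2_eq_square algebra_simps)
  finally show ?thesis .
qed

lemma not_kaehler_\<phi>2:
  assumes "kaehler_structure UNIV K" shows "\<not> holomorphic_wrt UNIV K \<phi>2"
proof
  assume "holomorphic_wrt UNIV K \<phi>2"
  from kaehler_holomorphic_pairing[OF assms this line_has_vector_derivative, of 0 "pt c 1"]
  show False using pairing_axis[of 0 1] by simp
qed

lemma not_superminimal_\<phi>2:
  assumes "hermitian_structure UNIV J'" shows "\<not> superminimal_fibres UNIV J' \<phi>2"
proof
  assume sm: "superminimal_fibres UNIV J' \<phi>2"
  have axis0: "\<phi>2 (0 + t *\<^sub>R pt c 1) = 0" for t
    using distinct by (auto simp: \<phi>2_def W1_def W2_def g_def intro!: sum.neutral)
  have "0 \<in> range \<phi>2"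
    using rangeI[of \<phi>2 "0 + 0 *\<^sub>R pt c 1"] unfolding axis0 .
  then have "superminimal UNIV J' {y\<in>UNIV. \<phi>2 y = 0}"
    using sm unfolding superminimal_fibres_def by blast
  moreover have "almost_hermitian_structure UNIV J'"
    using assms by (simp add: hermitian_structure_def)
  moreover have "v \<in> tangent_vectors {y\<in>UNIV. \<phi>2 y = 0} (0 + t *\<^sub>R pt c 1)"
    if "FD \<phi>2 (0 + t *\<^sub>R pt c 1) v = 0" for t v
    using kernel_tangent_\<phi>2[OF that] axis0 by simp
  ultimately have "\<exists>s\<in>{0,1,2}. \<exists>t\<in>{0,1,2}. s \<noteq> t \<and>
      pairing (FD \<phi>2 (0 + s *\<^sub>R pt c 1)) (FD \<phi>2 (0 + t *\<^sub>R pt c 1)) = 0"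
    using axis0 harmonic_morphism_if_holomorphic_harmonic[OF open_UNIV almost_hermitian_J0
        holomorphic_harmonic_\<phi>2] submersive_\<phi>2
    by (intro superminimal_line_pairing[where U = UNIV and J = J' and c = 0]) auto
  then obtain s t :: real where "s \<in> {0,1,2}" "t \<in> {0,1,2}" "s \<noteq> t" "-2 * (s + t) * (s - t)\<^sup>2 = 0"
    unfolding add_0 pairing_axis of_real_eq_0_iff by blast
  \<comment> \<open>Distinct elements of \<open>{0,1,2}\<close> have nonzero sum and difference;
    opposite parameters would pair to zero.\<close>
  then show False by auto
qed

section \<open>Obstructions for the first example\<close>

lemma not_kaehler_\<phi>1:
  assumes "kaehler_structure U1 K" shows "\<not> holomorphic_wrt U1 K \<phi>1"
proof
  assume h: "holomorphic_wrt U1 K \<phi>1"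
  \<comment> \<open>Along the \<open>z c\<close>-axis the differentials of \<open>\<phi>1\<close>
    pair to zero, so another line is used. The opposite signs make \<open>den\<close> equal to
    \<open>1 + t\<^sup>2\<close> on it, which keeps it in \<open>U1\<close>. The differential is
    \<open>dz\<^sub>a\<close> at the origin and contains the conjugate of \<open>dz\<^sub>a\<close>
    with coefficient \<open>-1/4\<close> at \<open>e\<close>.\<close>
  define e where "e = pt a 1 - pt c 1"
  have z_e: "z k e = (if k = a then 1 else if k = c then -1 else 0)" for k
    using distinct by (simp add: e_def)
  have g_e: "g (0 + t *\<^sub>R e) = 0" and dg_e: "dg (0 + t *\<^sub>R e) v = 0" for t v
    by (auto simp: g_def dg_def z_e intro!: sum.neutral)
  have den_e: "den (0 + t *\<^sub>R e) = 1 + of_real t * cnj (of_real t)" for t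
    using distinct by (simp add: dsimps z_e)
  have U: "0 + t *\<^sub>R e \<in> U1" for t
    using p.one_plus_nonzero[of "of_real t"] unfolding U1_def mem_Collect_eq den_e .
  have F0: "FD \<phi>1 0 v = z a v" for v
    using FD_\<phi>1[OF U[of 0]] dg_e[of 0] g_e[of 0] by (simp add: \<phi>1_def dsimps)
  have F1: "FD \<phi>1 e v = (z a v - cnj (z b v) - (z b v + cnj (z a v) - z c v) / 2) / 2" for v
    using FD_\<phi>1[OF U[of 1]] dg_e[of 1] g_e[of 1] distinct by (simp add: \<phi>1_def dsimps z_e)
  have "pairing (FD \<phi>1 0) (FD \<phi>1 e) = (\<Sum>k\<in>{a}.
      FD \<phi>1 0 (axis (Inl k) 1) * FD \<phi>1 e (axis (Inl k) 1)
      + FD \<phi>1 0 (axis (Inr k) 1) * FD \<phi>1 e (axis (Inr k) 1))"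
    unfolding pairing_split by (rule sum.mono_neutral_right) (auto simp: F0)
  also have "\<dots> = - (1 / 2)"
    using distinct by (simp add: F0 F1 field_simps)
  finally show False
    using kaehler_holomorphic_pairing[OF assms h line_has_vector_derivative, of 0 e] U by simp
qed

lemma J0_neq: "J0 0 (axis (Inl a) 1) \<noteq> J0 (pt c 1) (axis (Inl a) 1)"
proof
  assume "J0 0 (axis (Inl a) 1) = J0 (pt c 1) (axis (Inl a) 1)"
  then have "z a (J0 0 (axis (Inl a) 1)) = z a (J0 (pt c 1) (axis (Inl a) 1))" by simp
  then show False
    using distinct by (simp add: p.cstruct_def p.unshear_def p.covector_simps)
qed

text \<open>The \<open>z c\<close>-axis lies in the fibre over 0, but \<open>J0\<close> varies along
  it.\<close>

lemma not_superminimal_J0: "\<not> superminimal_fibres U1 J0 \<phi>1"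
proof
  assume sm: "superminimal_fibres U1 J0 \<phi>1"
  have "g (0 + t *\<^sub>R pt c 1) = 0" for t
    by (auto simp: g_def intro!: sum.neutral)
  then have ax: "0 + t *\<^sub>R pt c 1 \<in> {y\<in>U1. \<phi>1 y = 0}" for t
    using distinct by (simp add: U1_def \<phi>1_def dsimps)
  from ax[of 0] have "0 \<in> \<phi>1 ` U1" by force
  then have "superminimal U1 J0 {y\<in>U1. \<phi>1 y = 0}"
    using sm unfolding superminimal_fibres_def by blast
  from superminimal_constant_on_line[OF almost_hermitian_J0[OF open_U1] this ax, of 0 "axis (Inl a) 1" 1]
  show False using J0_neq by simp
qed

text \<open>\<open>J0\<close> varies only with \<open>z c\<close>, while on vectors of the
  \<open>z c\<close>-plane it acts as multiplication by \<open>\<i>\<close> at every point. Each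
  single term of the divergence therefore vanishes.\<close>

lemma cosymplectic_J0:
  assumes "open U" shows "cosymplectic U J0"
  unfolding cosymplectic_def divergence_def
proof (intro ballI sum.neutral)
  fix x e assume x: "x \<in> U" and e: "e \<in> (Basis :: (real^('m + 'm)) set)"
  then obtain i where i: "e = axis i 1" by (auto simp: Basis_vec_def)
  have "J0 (x + t *\<^sub>R e) e = J0 x e" for t
  proof (cases "z c e = 0")
    case True
    then show ?thesis by (simp add: p.cstruct_def)
  next
    case False
    then have "i = Inl c \<or> i = Inr c" unfolding i by (cases i) (auto split: if_splits)
    then have "z a e = 0" "z b e = 0" using distinct unfolding i by auto
    then show ?thesis using distinct
      by (intro p.coord_eqI) (simp add: p.cstruct_def p.unshear_def p.covector_simps)
  qed
  then show "FD (\<lambda>y. J0 y e) x e = 0"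
    using derivative_along_constant_curve[OF line_has_vector_derivative zero_less_one,
        of "\<lambda>y. J0 y e" x e] almost_hermitian_differentiable[OF almost_hermitian_J0[OF assms] x]
    by simp
qed

section \<open>The structure \<open>J1\<close> of opposite orientation\<close>

lemma q_covector:
  "q.covector m a v = z a v - m * z b v"
  "q.covector m b v = cnj (z b v) + m * cnj (z a v)"
  "k \<noteq> a \<Longrightarrow> k \<noteq> b \<Longrightarrow> q.covector m k v = z k v"
  using distinct by (simp_all add: q.covector_simps q_coord)

lemma holomorphic_J1: "holomorphic_wrt U1 J1 \<phi>1"
proof (rule holomorphic_wrtI[OF smooth_on_D(2)[OF smooth_\<phi>(1)]])
  fix x v assume x: "x \<in> U1"
  \<comment> \<open>The differential regroups into (1,0)-covectors for the parameter
    \<open>\<phi>1 x\<close>: the term \<open>- \<phi>1 x * dW2 x w\<close> supplies the second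
    summand of each sheared covector.\<close>
  have eq: "FD \<phi>1 x w = (q.covector (\<phi>1 x) a w + z c x * q.covector (\<phi>1 x) b w
      + q.covector (\<phi>1 x) c w * (cnj (z b x) + \<phi>1 x * cnj (z a x))
      + (\<Sum>k\<in>-{a,b,c}. 2 * z k x * q.covector (\<phi>1 x) k w)) / den x" for w
  proof -
    have "dg x w = (\<Sum>k\<in>-{a,b,c}. 2 * z k x * q.covector (\<phi>1 x) k w)"
      unfolding dg_def by (rule sum.cong) (auto simp: q_covector)
    then show ?thesis
      using distinct by (simp add: FD_\<phi>1[OF x] dW1_def dW2_def q_covector algebra_simps)
  qed
  show "FD \<phi>1 x (J1 x v) = \<i> * FD \<phi>1 x v"
    unfolding eq q.covector_cstruct by (simp add: sum_distrib_left algebra_simps)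
qed auto

text \<open>Clearing the denominator turns \<open>\<phi>1 x = m\<close> into a polynomial equation
  in the covectors for the parameter \<open>m\<close>. It expresses \<open>\<phi>1\<close> through
  the holomorphic coordinates of \<open>J1\<close>, the function \<open>h\<close> that
  \<open>hermitian_cstruct\<close> asks for.\<close>

lemma \<phi>1_eq_iff:
  assumes "x \<in> U1"
  shows "\<phi>1 x = m \<longleftrightarrow>
    q.covector m a x + q.covector m c x * q.covector m b x
      + (\<Sum>k\<in>-{a,b,c}. q.covector m k x * q.covector m k x) = m"
proof -
  have "(\<Sum>k\<in>-{a,b,c}. q.covector m k x * q.covector m k x) = g x"
    unfolding g_def by (rule sum.cong) (auto simp: q_covector)
  moreover have "den x \<noteq> 0" using assms by (simp add: U1_def)
  ultimately show ?thesis
    using distinct by (simp add: \<phi>1_def q_covector divide_eq_eq) (auto simp: dsimps algebra_simps)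
qed

lemma hermitian_J1: "hermitian_structure U1 J1"
proof (rule q.hermitian_cstruct[OF open_U1 smooth_\<phi>(1) holomorphic_J1])
  let ?h = "\<lambda>w::complex^'m. w $ a + w $ c * w $ b + (\<Sum>k\<in>-{a,b,c}. w $ k * w $ k)"
  show "smooth_on UNIV ?h"
    by (intro smooth_on_add smooth_on_mult smooth_on_sum open_UNIV
        smooth_on_bounded_linear[OF _ bounded_linear_vec_nth])
  show "?h (\<chi> k. q.covector (\<phi>1 x) k x) = \<phi>1 x" if "x \<in> U1" for x
    using \<phi>1_eq_iff[OF that, of "\<phi>1 x"] by simp
  show "\<phi>1 (q.assemble (q.unshear (?h w) (\<lambda>k. w $ k))) = ?h w"
    if "q.assemble (q.unshear (?h w) (\<lambda>k. w $ k)) \<in> U1" for w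
    using \<phi>1_eq_iff[OF that, of "?h w"] by simp
qed

lemma superminimal_J1: "superminimal_fibres U1 J1 \<phi>1"
proof (rule superminimal_fibresI)
  have "DIM(real^('m + 'm)) = 2 * CARD('m)"
    by (simp add: UNIV_Plus_UNIV[symmetric] card_Plus del: UNIV_Plus_UNIV)
  moreover have "CARD('m) \<ge> 1" by (simp add: Suc_le_eq)
  ultimately show "even DIM(real^('m + 'm))" "DIM(real^('m + 'm)) \<ge> 2"
    unfolding \<open>DIM(real^('m + 'm)) = 2 * CARD('m)\<close> by (simp, linarith)
  show "J1 x = J1 y" if "\<phi>1 x = \<phi>1 y" for x y
    using that by (simp add: q.cstruct_def fun_eq_iff)
qed (use open_U1 smooth_\<phi>(1) q.almost_hermitian_cstruct submersive_\<phi>1 holomorphic_J1 kernel_tangent_\<phi>1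
  in auto)

text \<open>One coordinate of the divergence at one point suffices. At \<open>pt c 1\<close> the
  value of \<open>\<phi>1\<close> is 0 and its differential contains the conjugate of
  \<open>dz\<^sub>b\<close>, which pairs nontrivially with \<open>dz\<^sub>b\<close>.\<close>

lemma not_cosymplectic_J1: "\<not> cosymplectic U1 J1"
proof
  let ?x = "pt c 1"
  assume "cosymplectic U1 J1"
  moreover have x: "?x \<in> U1" using distinct by (simp add: U1_def dsimps)
  ultimately have "divergence J1 ?x = 0" by (simp add: cosymplectic_def)
  have \<phi>0: "\<phi>1 ?x = 0" using distinct by (simp add: \<phi>1_def dsimps g_pt)
  have d: "FD \<phi>1 ?x v = z a v + cnj (z b v)" for v
    using FD_\<phi>1[OF x] \<phi>0 distinct by (simp add: dsimps dg_pt)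
  \<comment> \<open>The conjugate of \<open>\<phi>1\<close> occurs only in its squared modulus,
    which has zero derivative where \<open>\<phi>1\<close> vanishes; only the term linear in
    \<open>\<phi>1\<close> survives.\<close>
  have D: "q.coord a (FD (\<lambda>y. J1 y w) ?x v) = -2 * \<i> * FD \<phi>1 ?x v * z b w" for v w
  proof -
    have "((\<lambda>y. J1 y w) has_derivative FD (\<lambda>y. J1 y w) ?x) (at ?x)"
      using almost_hermitian_differentiable[OF q.almost_hermitian_cstruct[OF open_U1 smooth_\<phi>(1)] x]
      by (simp add: frechet_derivative_works)
    then have 1: "((\<lambda>y. q.coord a (J1 y w)) has_derivative (\<lambda>v. q.coord a (FD (\<lambda>y. J1 y w) ?x v))) (at ?x)"
      by (rule bounded_linear.has_derivative[OF q.bounded_linear_coord])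
    have f: "(\<phi>1 has_derivative FD \<phi>1 ?x) (at ?x)"
      using smooth_on_D(2)[OF smooth_\<phi>(1) x] .
    note fc = bounded_linear.has_derivative[OF bounded_linear_cnj f]
    have "(\<lambda>y. q.coord a (J1 y w)) = (\<lambda>y. \<i> * (z a w - 2 * \<phi>1 y * z b w - \<phi>1 y * cnj (\<phi>1 y) * z a w)
        / (1 + \<phi>1 y * cnj (\<phi>1 y)))"
      using distinct by (simp add: fun_eq_iff q.cstruct_def q.unshear_def q_covector algebra_simps)
    moreover have "((\<lambda>y. \<i> * (z a w - 2 * \<phi>1 y * z b w - \<phi>1 y * cnj (\<phi>1 y) * z a w)
        / (1 + \<phi>1 y * cnj (\<phi>1 y))) has_derivative (\<lambda>v. -2 * \<i> * FD \<phi>1 ?x v * z b w)) (at ?x)"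
      by (rule derivative_eq_intros f fc refl | simp add: \<phi>0 fun_eq_iff)+
    ultimately have "((\<lambda>y. q.coord a (J1 y w)) has_derivative (\<lambda>v. -2 * \<i> * FD \<phi>1 ?x v * z b w)) (at ?x)"
      by simp
    from has_derivative_unique[OF 1 this] show ?thesis by (rule fun_cong)
  qed
  have "divergence J1 ?x = (\<Sum>i\<in>UNIV. FD (\<lambda>y. J1 y (axis i 1)) ?x (axis i 1))"
  proof -
    have basis: "Basis = range (\<lambda>i. axis i 1 :: real^('m + 'm))" by (auto simp: Basis_vec_def)
    have inj: "inj (\<lambda>i. axis i 1 :: real^('m + 'm))" by (simp add: inj_on_def axis_eq_axis)
    show ?thesis unfolding divergence_def basis by (subst sum.reindex[OF inj]) (simp add: o_def)
  qed
  then have "q.coord a (divergence J1 ?x)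
      = (\<Sum>i\<in>UNIV. -2 * \<i> * FD \<phi>1 ?x (axis i 1) * z b (axis i 1))"
    using bounded_linear.linear[OF q.bounded_linear_coord] by (simp add: linear_sum D)
  \<comment> \<open>The factor \<open>z b\<close> restricts the sum to \<open>k = b\<close>, where
    the two axis directions contribute equally.\<close>
  also have "\<dots> = (\<Sum>k\<in>UNIV. if k = b then -4 * \<i> else 0)"
    unfolding sum_UNIV_Plus sum.distrib[symmetric] d using distinct
    by (intro sum.cong refl) (auto simp: mult.assoc)
  also have "\<dots> = -4 * \<i>" by simp
  finally show False using \<open>divergence J1 ?x = 0\<close> by simp
qed

section \<open>Assembly of the examples\<close>

lemma examples:
  "full_non_kaehler_example U1 \<phi>1 J1" "full_non_kaehler_example U1 \<phi>1 J0"
  "full_non_kaehler_example UNIV \<phi>2 J0"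
proof -
  have "pt c 1 \<in> U1" using distinct by (simp add: U1_def dsimps)
  then show "full_non_kaehler_example U1 \<phi>1 J1" "full_non_kaehler_example U1 \<phi>1 J0"
    "full_non_kaehler_example UNIV \<phi>2 J0"
    unfolding full_non_kaehler_example_def
    using open_U1 harmonic_morphism_if_holomorphic_harmonic[OF open_U1 almost_hermitian_J0
        holomorphic_harmonic_\<phi>1] harmonic_morphism_if_holomorphic_harmonic[OF open_UNIV
        almost_hermitian_J0 holomorphic_harmonic_\<phi>2]
      full_\<phi>1 full_\<phi>2 hermitian_J0 hermitian_J1 holomorphic_J1 holomorphic_\<phi> not_kaehler_\<phi>1 not_kaehler_\<phi>2
    by auto
qed

end

theorem theorem4p15:
  assumes "CARD('m::finite) > 2"
  shows "(\<exists>(U :: (real^('m + 'm)) set) \<phi> J. full_non_kaehler_example U \<phi> J) \<and>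
     (\<exists>(U :: (real^('m + 'm)) set) \<phi> J. full_non_kaehler_example U \<phi> J \<and>
           submersive_on U \<phi> \<and> superminimal_fibres U J \<phi>) \<and>
     (\<exists>(U :: (real^('m + 'm)) set) \<phi> J. full_non_kaehler_example U \<phi> J \<and>
           submersive_on U \<phi> \<and>
           (\<forall>J'. hermitian_structure U J' \<longrightarrow> \<not> superminimal_fibres U J' \<phi>)) \<and>
     (\<exists>(U :: (real^('m + 'm)) set) \<phi> J. full_non_kaehler_example U \<phi> J \<and> cosymplectic U J) \<and>
     (\<exists>(U :: (real^('m + 'm)) set) \<phi> J. full_non_kaehler_example U \<phi> J \<and> \<not> cosymplectic U J) \<and>
     (\<exists>(U :: (real^('m + 'm)) set) \<phi> J \<J>. full_non_kaehler_example U \<phi> J \<and> J \<in> \<J> \<and>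
           (\<forall>J'\<in>\<J>. hermitian_structure U J' \<and> holomorphic_wrt U J' \<phi>) \<and>
           (\<exists>J'\<in>\<J>. superminimal_fibres U J' \<phi>) \<and>
           (\<exists>J'\<in>\<J>. \<not> superminimal_fibres U J' \<phi>))"
  (is "(\<exists>U \<phi> J. ?E U \<phi> J) \<and> ?a \<and> ?b \<and> ?c \<and> ?d \<and> ?e")
proof -
  \<comment> \<open>The bound on the dimension supplies the three distinct coordinates on which both
    examples rest.\<close>
  obtain T :: "'m set" where "card T = 3"
    using assms obtain_subset_with_card_n[of 3 "UNIV :: 'm set"] by auto
  then obtain a b c :: 'm where "a \<noteq> b" "a \<noteq> c" "b \<noteq> c"
    unfolding card_3_iff by blast
  then interpret three_indices a b c by unfold_locales
  have a: ?a using examples(1) submersive_\<phi>1 superminimal_J1 by blast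
  have b: ?b using examples(3) submersive_\<phi>2 not_superminimal_\<phi>2 by blast
  have c: ?c using examples(3) cosymplectic_J0[OF open_UNIV] by blast
  have d: ?d using examples(1) not_cosymplectic_J1 by blast
  have "\<forall>J'\<in>{J0, J1}. hermitian_structure U1 J' \<and> holomorphic_wrt U1 J' \<phi>1"
    using hermitian_J0[OF open_U1] hermitian_J1 holomorphic_J1 holomorphic_\<phi>(1) by blast
  then have e: ?e
    using examples(1) superminimal_J1 not_superminimal_J0
    by (intro exI[of _ U1] exI[of _ \<phi>1] exI[of _ J1] exI[of _ "{J0, J1}"]) blast
  from a b c d e show ?thesis by blast
qed

end
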